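(* Let $d \geq 2$ be an integer. Every claw-free graph $G=(V,E)$ with maximum degree $\Delta(G) \leq 2d+1$ and $|V| > 4d^2(2d+1)$ has a $d$-cut, and such a $d$-cut can be found in time linear in the size of $G$. Moreover, there exist arbitrarily large claw-free $(2d+2)$-regular graphs that have no $d$-cut.
   Context: All graphs are finite, simple and undirected. A graph is claw-free if it contains no induced subgraph isomorphic to the claw $K_{1,3}$ (the star with three leaves). For an integer $d\geq 1$ and a graph $G=(V,E)$, a set $M\subseteq E$ is a $d$-cut of $G$ if $V$ can be partitioned into two non-empty sets $B$ and $R$ such that $M$ is exactly the set of edges with one end in $B$ and the other in $R$, and every vertex of $B$ has at most $d$ neighbours in $R$ and every vertex of $R$ has at most $d$ neighbours in $B$. A graph is $r$-regular if every vertex has degree exactly $r$. *)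

theory Defs
  imports Main
begin

section \<open>Finite simple graphs\<close>

definition simple_graph :: "'a set \<Rightarrow> 'a set set \<Rightarrow> bool" where
  "simple_graph V E \<longleftrightarrow> finite V \<and> (\<forall>e\<in>E. e \<subseteq> V \<and> card e = 2)"

definition neighbours :: "'a set set \<Rightarrow> 'a \<Rightarrow> 'a set" where
  "neighbours E v = {u. {v, u} \<in> E}"

definition degree :: "'a set set \<Rightarrow> 'a \<Rightarrow> nat" where
  "degree E v = card (neighbours E v)"

text \<open>Meaningful for nonempty \<open>V\<close> only.\<close>

definition max_degree :: "'a set \<Rightarrow> 'a set set \<Rightarrow> nat" where
  "max_degree V E = Max (degree E ` V)"

definition regular :: "nat \<Rightarrow> 'a set \<Rightarrow> 'a set set \<Rightarrow> bool" where
  "regular r V E \<longleftrightarrow> (\<forall>v\<in>V. degree E v = r)"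

definition induced_edges :: "'a set set \<Rightarrow> 'a set \<Rightarrow> 'a set set" where
  "induced_edges E S = {e \<in> E. e \<subseteq> S}"

definition isomorphic :: "'a set \<Rightarrow> 'a set set \<Rightarrow> 'b set \<Rightarrow> 'b set set \<Rightarrow> bool" where
  "isomorphic V E V' E' \<longleftrightarrow>
     (\<exists>f. bij_betw f V V' \<and> (\<forall>u\<in>V. \<forall>v\<in>V. {u, v} \<in> E \<longleftrightarrow> {f u, f v} \<in> E'))"

definition claw_vertices :: "nat set" where
  "claw_vertices = {0, 1, 2, 3}"

definition claw_edges :: "nat set set" where
  "claw_edges = {{0, 1}, {0, 2}, {0, 3}}"

definition claw_free :: "'a set \<Rightarrow> 'a set set \<Rightarrow> bool" where
  "claw_free V E \<longleftrightarrow>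
     \<not> (\<exists>S\<subseteq>V. isomorphic S (induced_edges E S) claw_vertices claw_edges)"

definition d_cut :: "nat \<Rightarrow> 'a set \<Rightarrow> 'a set set \<Rightarrow> 'a set set \<Rightarrow> bool" where
  "d_cut d V E M \<longleftrightarrow>
     (\<exists>B R. B \<union> R = V \<and> B \<inter> R = {} \<and> B \<noteq> {} \<and> R \<noteq> {} \<and>
        M = {e \<in> E. \<exists>b\<in>B. \<exists>r\<in>R. e = {b, r}} \<and>
        (\<forall>v\<in>B. card (neighbours E v \<inter> R) \<le> d) \<and>
        (\<forall>v\<in>R. card (neighbours E v \<inter> B) \<le> d))"

section \<open>A unit-cost word RAM\<close>

text \<open>
  Programs are structured programs over registers and one random-access memory, both holding
  natural numbers, with a write-only output tape. Arithmetic is limited to addition and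
  truncated subtraction. Every instruction and every evaluation of a test costs one time unit.
\<close>

datatype com =
    Const nat nat
  | Add nat nat nat
  | Sub nat nat nat
  | Load nat nat
  | Store nat nat
  | Print nat
  | Seq com com
  | IfLess nat nat com com
  | WhileLess nat nat com

record config =
  regs :: "nat \<Rightarrow> nat"
  memory :: "nat \<Rightarrow> nat"
  printed :: "nat list"

text \<open>
  \<open>exec W c s t s'\<close>: with machine words \<open>{0..W}\<close>, the program \<open>c\<close> started in \<open>s\<close> halts in \<open>s'\<close>
  after exactly \<open>t\<close> time units. A program that would produce a number above \<open>W\<close> is stuck, so
  the word size is \<open>O(log W)\<close> bits and the unit-cost measure cannot be exploited by
  computing with huge numbers.
\<close>

inductive exec :: "nat \<Rightarrow> com \<Rightarrow> config \<Rightarrow> nat \<Rightarrow> config \<Rightarrow> bool" for W :: nat where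
  Const: "k \<le> W \<Longrightarrow> exec W (Const x k) s 1 (s\<lparr>regs := (regs s)(x := k)\<rparr>)"
| Add: "regs s y + regs s z \<le> W \<Longrightarrow>
    exec W (Add x y z) s 1 (s\<lparr>regs := (regs s)(x := regs s y + regs s z)\<rparr>)"
| Sub: "exec W (Sub x y z) s 1 (s\<lparr>regs := (regs s)(x := regs s y - regs s z)\<rparr>)"
| Load: "exec W (Load x y) s 1 (s\<lparr>regs := (regs s)(x := memory s (regs s y))\<rparr>)"
| Store: "exec W (Store x y) s 1 (s\<lparr>memory := (memory s)(regs s x := regs s y)\<rparr>)"
| Print: "exec W (Print x) s 1 (s\<lparr>printed := printed s @ [regs s x]\<rparr>)"
| Seq: "exec W c1 s t1 s' \<Longrightarrow> exec W c2 s' t2 s'' \<Longrightarrow> exec W (Seq c1 c2) s (t1 + t2) s''"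
| IfTrue: "regs s x < regs s y \<Longrightarrow> exec W c1 s t s' \<Longrightarrow> exec W (IfLess x y c1 c2) s (1 + t) s'"
| IfFalse: "\<not> regs s x < regs s y \<Longrightarrow> exec W c2 s t s' \<Longrightarrow>
    exec W (IfLess x y c1 c2) s (1 + t) s'"
| WhileFalse: "\<not> regs s x < regs s y \<Longrightarrow> exec W (WhileLess x y c) s 1 s"
| WhileTrue: "regs s x < regs s y \<Longrightarrow> exec W c s t1 s' \<Longrightarrow> exec W (WhileLess x y c) s' t2 s'' \<Longrightarrow>
    exec W (WhileLess x y c) s (1 + t1 + t2) s''"

inductive_cases exec_ConstE: "exec W (Const x k) s t s'"
inductive_cases exec_AddE: "exec W (Add x y z) s t s'"
inductive_cases exec_SubE: "exec W (Sub x y z) s t s'"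
inductive_cases exec_LoadE: "exec W (Load x y) s t s'"
inductive_cases exec_StoreE: "exec W (Store x y) s t s'"
inductive_cases exec_PrintE: "exec W (Print x) s t s'"
inductive_cases exec_SeqE: "exec W (Seq c1 c2) s t s'"
inductive_cases exec_IfE: "exec W (IfLess x y c1 c2) s t s'"
inductive_cases exec_WhileE: "exec W (WhileLess x y c) s t s'"

lemma exec_deterministic:
  assumes "exec W c s t s'" and "exec W c s u s''"
  shows "u = t \<and> s'' = s'"
  using assms
proof (induction arbitrary: u s'' rule: exec.induct)
  case (Seq c1 s t1 s1 c2 t2 s2)
  from Seq.prems obtain v1 v2 s3 where
    "u = v1 + v2" "exec W c1 s v1 s3" "exec W c2 s3 v2 s''"
    by (rule exec_SeqE)
  with Seq.IH show ?case by metis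
next
  case (IfTrue s x y c1 t s1 c2)
  from IfTrue.prems IfTrue.hyps(1) obtain v where "u = 1 + v" "exec W c1 s v s''"
    by (auto elim: exec_IfE)
  with IfTrue.IH show ?case by metis
next
  case (IfFalse s x y c2 t s1 c1)
  from IfFalse.prems IfFalse.hyps(1) obtain v where "u = 1 + v" "exec W c2 s v s''"
    by (auto elim: exec_IfE)
  with IfFalse.IH show ?case by metis
next
  case (WhileFalse s x y c)
  from WhileFalse.prems WhileFalse.hyps show ?case by (auto elim: exec_WhileE)
next
  case (WhileTrue s x y c t1 s1 t2 s2)
  from WhileTrue.prems obtain v1 v2 s3 where
    "u = 1 + v1 + v2" "exec W c s v1 s3" "exec W (WhileLess x y c) s3 v2 s''"
    by (rule exec_WhileE) (use WhileTrue.hyps(1) in simp_all)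
  with WhileTrue.IH show ?case by metis
qed (auto elim: exec_ConstE exec_AddE exec_SubE exec_LoadE exec_StoreE exec_PrintE)

definition initial_config :: "nat list \<Rightarrow> config" where
  "initial_config xs =
     \<lparr>regs = (\<lambda>_. 0), memory = (\<lambda>i. if i < length xs then xs ! i else 0), printed = []\<rparr>"

definition runs :: "nat \<Rightarrow> com \<Rightarrow> nat list \<Rightarrow> nat \<Rightarrow> nat list \<Rightarrow> bool" where
  "runs W c xs t ys \<longleftrightarrow>
     (\<forall>x\<in>set xs. x \<le> W) \<and> (\<exists>s. exec W c (initial_config xs) t s \<and> printed s = ys)"

section \<open>Graphs as input and edge sets as output\<close>

definition adjacency_lists :: "nat \<Rightarrow> nat set set \<Rightarrow> nat list list \<Rightarrow> bool" where
  "adjacency_lists n E adj \<longleftrightarrow>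
     length adj = n \<and> (\<forall>v<n. distinct (adj ! v) \<and> set (adj ! v) = neighbours E v)"

text \<open>
  Memory layout: cell \<open>0\<close> holds the number \<open>n\<close> of vertices; for \<open>v < n\<close>, cells \<open>1 + v\<close> and
  \<open>2 + v\<close> hold the address of the first entry of the list of \<open>v\<close> and the address just
  behind its last entry; the concatenated adjacency lists start at address \<open>n + 2\<close>.
\<close>

definition encode_graph :: "nat list list \<Rightarrow> nat list" where
  "encode_graph adj =
     length adj #
     map (\<lambda>v. length adj + 2 + length (concat (take v adj))) [0..<length adj + 1] @
     concat adj"

text \<open>An edge set is printed as a list of edges, each given by its two ends.\<close>

definition encodes_edges :: "nat list \<Rightarrow> nat set set \<Rightarrow> bool" where
  "encodes_edges ys M \<longleftrightarrow>
     (\<exists>ps. ys = concat (map (\<lambda>(u, v). [u, v]) ps) \<and> M = (\<lambda>(u, v). {u, v}) ` set ps)"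

end

theory Submission
  imports Defs
begin

text \<open>
  In a graph of maximum degree at most \<open>2 * d + 1\<close>, moving a vertex with more than \<open>d\<close> neighbours in
  \<open>X\<close> into \<open>X\<close> makes the cut around \<open>X\<close> strictly smaller. So once a bounded nonempty set is found
  in which every vertex has at most \<open>d\<close> neighbours outside, absorbing such vertices stops after
  boundedly many steps, and in a large graph it stops at a \<open>d\<close>-cut. By claw-freeness, the closed
  neighbourhood of a vertex of maximum degree contains a set of this kind, and the largest one is
  what remains of the neighbourhood when its complement absorbs vertices. As \<open>d\<close> is fixed, a constant
  number of linear scans over the graph suffices for both phases.

  For the second part, the \<open>(d + 1)\<close>-st power of a long cycle is claw-free and \<open>(2 * d + 2)\<close>-regular,
  and consecutive vertices have too many common neighbours to be separated by a \<open>d\<close>-cut.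
\<close>

section \<open>Cores in claw-free graphs\<close>

lemma neighbours_sym: "u \<in> neighbours E v \<longleftrightarrow> v \<in> neighbours E u"
  by (simp add: neighbours_def insert_commute)

lemma neighbours_subset: "simple_graph V E \<Longrightarrow> neighbours E v \<subseteq> V"
  by (auto simp: neighbours_def simple_graph_def)

lemma not_self_neighbour: "simple_graph V E \<Longrightarrow> v \<notin> neighbours E v"
  by (auto simp: neighbours_def simple_graph_def)

lemma finite_neighbours: "simple_graph V E \<Longrightarrow> finite (neighbours E v)"
  using neighbours_subset finite_subset simple_graph_def by metis

lemma degree_le_max_degree:
  "simple_graph V E \<Longrightarrow> v \<in> V \<Longrightarrow> degree E v \<le> max_degree V E"
  by (auto simp: max_degree_def simple_graph_def)

text \<open>Both uses of claw-freeness argue with three pairwise non-adjacent neighbours of a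
  vertex; the isomorphism with the standard claw is eliminated here once and for all. Label 0 is the
  centre, 1 to 3 are the leaves.\<close>

lemma claw_free_iff:
  assumes "simple_graph V E"
  shows "claw_free V E \<longleftrightarrow>
    \<not> (\<exists>v\<in>V. \<exists>a b c. {a, b, c} \<subseteq> neighbours E v \<and> distinct [a, b, c] \<and>
        a \<notin> neighbours E b \<and> a \<notin> neighbours E c \<and> b \<notin> neighbours E c)"
    (is "_ \<longleftrightarrow> \<not> ?claw")
proof -
  have "?claw" if "S \<subseteq> V" "isomorphic S (induced_edges E S) claw_vertices claw_edges" for S
  proof -
    from that obtain f where f: "bij_betw f S {0, 1, 2, 3 :: nat}"
      and adj: "\<And>u v. u \<in> S \<Longrightarrow> v \<in> S \<Longrightarrow> {u, v} \<in> induced_edges E S \<longleftrightarrow> {f u, f v} \<in> claw_edges"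
      by (auto simp: isomorphic_def claw_vertices_def)
    define g where "g = inv_into S f"
    have g: "g k \<in> S \<and> f (g k) = k" if "k \<in> {0, 1, 2, 3}" for k
      using that f unfolding g_def bij_betw_def by (metis f_inv_into_f inv_into_into)
    have "g j \<in> neighbours E (g i) \<longleftrightarrow> {i, j} \<in> claw_edges"
      if "i \<in> {0, 1, 2, 3}" "j \<in> {0, 1, 2, 3}" for i j
      using adj[of "g i" "g j"] g[OF that(1)] g[OF that(2)]
      by (simp add: neighbours_def induced_edges_def)
    moreover have "g i \<noteq> g j" if "i \<in> {0, 1, 2, 3}" "j \<in> {0, 1, 2, 3}" "i \<noteq> j" for i j
      using g that by metis
    ultimately have "{g 1, g 2, g 3} \<subseteq> neighbours E (g 0) \<and> distinct [g 1, g 2, g 3] \<and>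
        g 1 \<notin> neighbours E (g 2) \<and> g 1 \<notin> neighbours E (g 3) \<and> g 2 \<notin> neighbours E (g 3)"
      by (simp add: claw_edges_def doubleton_eq_iff)
    then show ?thesis
      using g[of 0] that(1) by blast
  qed
  moreover have "\<not> claw_free V E" if "?claw"
  proof -
    from that obtain v a b c where v: "v \<in> V"
      and ne: "a \<in> neighbours E v" "b \<in> neighbours E v" "c \<in> neighbours E v"
        "distinct [a, b, c]"
        "a \<notin> neighbours E b" "a \<notin> neighbours E c" "b \<notin> neighbours E c"
      by auto
    have edges: "{v, a} \<in> E" "{v, b} \<in> E" "{v, c} \<in> E" "{a, b} \<notin> E" "{a, c} \<notin> E" "{b, c} \<notin> E"
      using ne by (auto simp: neighbours_def insert_commute)
    \<comment> \<open>Edges have two elements, which separates the centre from the leaves.\<close>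
    have loop: "{x} \<notin> E" for x
      using assms by (auto simp: simple_graph_def)
    have dist: "v \<noteq> a" "v \<noteq> b" "v \<noteq> c" "a \<noteq> b" "a \<noteq> c" "b \<noteq> c"
      using ne edges loop by auto
    define f where "f x = (if x = v then 0 else if x = a then 1 else if x = b then 2 else 3 :: nat)" for x
    have "bij_betw f {v, a, b, c} claw_vertices"
      using dist by (auto simp: bij_betw_def inj_on_def f_def claw_vertices_def)
    moreover have "{x, y} \<in> induced_edges E {v, a, b, c} \<longleftrightarrow> {f x, f y} \<in> claw_edges"
      if "x \<in> {v, a, b, c}" "y \<in> {v, a, b, c}" for x y
      using that dist edges loop
      by (auto simp: f_def claw_edges_def induced_edges_def doubleton_eq_iff insert_commute)
    ultimately have "isomorphic {v, a, b, c} (induced_edges E {v, a, b, c}) claw_vertices claw_edges"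
      unfolding isomorphic_def by blast
    moreover have "{v, a, b, c} \<subseteq> V"
      using v ne(1-3) neighbours_subset[OF assms] by blast
    ultimately show ?thesis
      unfolding claw_free_def by blast
  qed
  ultimately show ?thesis
    unfolding claw_free_def by blast
qed

text \<open>The vertices of the core may all stay on one side of a \<open>d\<close>-cut: each of them has at most
  \<open>d\<close> neighbours outside. If no neighbour of \<open>v\<close> has more than \<open>d\<close> non-neighbours within the
  neighbourhood of \<open>v\<close>, the closed neighbourhood of \<open>v\<close> is a core; otherwise
  claw-freeness makes such non-neighbours together with \<open>v\<close> a clique on at least \<open>d + 2\<close>
  vertices.\<close>

lemma claw_free_core:
  assumes G: "simple_graph V E" and claw: "claw_free V E"
    and deg: "\<And>u. u \<in> V \<Longrightarrow> degree E u \<le> 2 * d + 1"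
    and v: "v \<in> V" and max: "\<And>u. u \<in> V \<Longrightarrow> degree E u \<le> degree E v"
  obtains C where "v \<in> C" "C \<subseteq> insert v (neighbours E v)"
    "\<And>c. c \<in> C \<Longrightarrow> card (neighbours E c - C) \<le> d"
proof -
  note fin = finite_neighbours[OF G] and sub = neighbours_subset[OF G]
    and irrefl = not_self_neighbour[OF G]
  have split: "card (neighbours E c - C) + card (neighbours E c \<inter> C) = degree E c" for c C
    using fin[of c] unfolding degree_def by (subst card_Int_Diff[of _ C]) auto
  show ?thesis
  proof (cases "\<exists>u \<in> neighbours E v. d < card (neighbours E v - neighbours E u - {u})")
    case True
    then obtain u where u: "u \<in> neighbours E v" "d < card (neighbours E v - neighbours E u - {u})"
      by auto
    define Q where "Q = neighbours E v - neighbours E u - {u}"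
    have "x \<in> neighbours E y" if "x \<in> Q" "y \<in> Q" "x \<noteq> y" for x y
    proof (rule ccontr)
      assume "x \<notin> neighbours E y"
      moreover have "x \<in> neighbours E v" "y \<in> neighbours E v" "x \<noteq> u" "y \<noteq> u"
        "x \<notin> neighbours E u" "y \<notin> neighbours E u"
        using that by (auto simp: Q_def)
      ultimately have "{x, y, u} \<subseteq> neighbours E v \<and> distinct [x, y, u] \<and> x \<notin> neighbours E y \<and>
          x \<notin> neighbours E u \<and> y \<notin> neighbours E u"
        using that(3) u(1) by simp
      then show False
        using claw v unfolding claw_free_iff[OF G] by blast
    qed
    moreover have "x \<in> neighbours E v" "v \<in> neighbours E x" if "x \<in> Q" for x
      using that neighbours_sym[of x E v] by (auto simp: Q_def)
    ultimately have nb: "insert v Q - {c} \<subseteq> neighbours E c \<inter> insert v Q" if "c \<in> insert v Q" for c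
      using that by blast
    have finQ: "finite Q" and vQ: "v \<notin> Q"
      using fin irrefl by (auto simp: Q_def)
    \<comment> \<open>In the clique \<open>insert v Q\<close> the vertex \<open>c\<close> has
      \<open>card Q\<close>, hence at least \<open>d + 1\<close>, neighbours. Of its at most
      \<open>2 * d + 1\<close> neighbours, at most \<open>d\<close> remain outside.\<close>
    have "card (neighbours E c - insert v Q) \<le> d" if c: "c \<in> insert v Q" for c
    proof -
      have "card (insert v Q - {c}) = card Q"
        using c finQ vQ by simp
      then have "card Q \<le> card (neighbours E c \<inter> insert v Q)"
        using card_mono[OF _ nb[OF c]] fin by simp
      moreover have "c \<in> V"
        using c v sub by (auto simp: Q_def)
      ultimately show ?thesis
        using split[of c "insert v Q"] deg[of c] u(2) by (simp add: Q_def)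
    qed
    then show ?thesis
      by (intro that[of "insert v Q"]) (auto simp: Q_def)
  next
    case False
    have "card (neighbours E c - insert v (neighbours E v)) \<le> d"
      if c: "c \<in> insert v (neighbours E v)" for c
    proof (cases "c = v")
      case True
      then show ?thesis
        by (simp add: Diff_eq_empty_iff[THEN iffD2] subset_insertI)
    next
      case ne: False
      then have cv: "c \<in> neighbours E v" "v \<in> neighbours E c"
        using c neighbours_sym[of c E v] by auto
      \<comment> \<open>Within the neighbourhood of \<open>v\<close>, \<open>c\<close> misses
        itself, but it gains \<open>v\<close>. As \<open>degree E c \<le> degree E v\<close>, it has
        at most as many neighbours outside as it has non-neighbours inside.\<close>
      have "degree E v \<le> card (neighbours E v - neighbours E c - {c}) +
          card (neighbours E c \<inter> insert v (neighbours E v))"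
      proof -
        have "neighbours E c \<inter> insert v (neighbours E v) = insert v (neighbours E c \<inter> neighbours E v)"
          using cv by auto
        moreover have "v \<notin> neighbours E c \<inter> neighbours E v"
          using irrefl by simp
        ultimately have "card (neighbours E c \<inter> insert v (neighbours E v)) =
            Suc (card (neighbours E c \<inter> neighbours E v))"
          using fin by simp
        moreover have "Suc (card (neighbours E v - neighbours E c - {c})) =
            card (neighbours E v - neighbours E c)"
          using card_Suc_Diff1[of "neighbours E v - neighbours E c" c] cv(1) irrefl[of c] fin[of v]
          by simp
        moreover have "degree E v = card (neighbours E v - neighbours E c) +
            card (neighbours E c \<inter> neighbours E v)"
          using split[of v "neighbours E c"] by (simp add: Int_commute)
        ultimately show ?thesis
          by simp
      qed
      moreover have "card (neighbours E v - neighbours E c - {c}) \<le> d"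
        using False cv(1) by (meson not_le)
      moreover have "degree E c \<le> degree E v"
        using max cv(1) sub by blast
      ultimately show ?thesis
        using split[of c "insert v (neighbours E v)"] by linarith
    qed
    then show ?thesis
      by (intro that[of "insert v (neighbours E v)"]) auto
  qed
qed

section \<open>Absorbing vertices with many neighbours in a set\<close>

definition absorb :: "nat \<Rightarrow> 'a set set \<Rightarrow> 'a \<Rightarrow> 'a set \<Rightarrow> 'a set" where
  "absorb d E v X = (if d < card (neighbours E v \<inter> X) then insert v X else X)"

text \<open>The set changes while the list is traversed, as when a program marks vertices in place:
  later tests see earlier absorptions.\<close>

definition absorb_pass :: "nat \<Rightarrow> 'a set set \<Rightarrow> 'a list \<Rightarrow> 'a set \<Rightarrow> 'a set" where
  "absorb_pass d E = fold (absorb d E)"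

lemma absorb_pass_invariant:
  assumes "\<And>v X. v \<in> set vs \<Longrightarrow> I X \<Longrightarrow> I (absorb d E v X)" and "I X"
  shows "I (absorb_pass d E vs X)"
  unfolding absorb_pass_def using assms(2,1)
  by (induction vs arbitrary: X) auto

lemma absorb_pass_mono: "X \<subseteq> absorb_pass d E vs X"
  by (rule absorb_pass_invariant) (auto simp: absorb_def)

text \<open>Absorption only adds vertices, so a pass that ends where it began never changed the set.
  Hence \<open>v\<close> was tested against \<open>X\<close> itself and failed.\<close>

lemma absorb_pass_closed:
  assumes "absorb_pass d E vs X = X" and "v \<in> set vs" and "v \<notin> X"
  shows "card (neighbours E v \<inter> X) \<le> d"
proof (rule ccontr)
  assume big: "\<not> ?thesis"
  obtain us ws where vs: "vs = us @ v # ws"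
    using assms(2) split_list by metis
  define Y where "Y = absorb_pass d E us X"
  have eq: "absorb_pass d E vs X = absorb_pass d E ws (absorb d E v Y)"
    by (simp add: vs Y_def absorb_pass_def)
  have "absorb d E v Y \<subseteq> X"
    using absorb_pass_mono[of "absorb d E v Y"] eq assms(1) by metis
  moreover have "X \<subseteq> Y"
    using absorb_pass_mono Y_def by metis
  moreover have "Y \<subseteq> absorb d E v Y"
    by (auto simp: absorb_def)
  ultimately have "Y = X" "absorb d E v Y \<subseteq> X"
    by auto
  then show False
    using big assms(3) by (simp add: absorb_def)
qed

lemma funpow_invariant:
  assumes "\<And>X. I X \<Longrightarrow> I (f X)" and "I X"
  shows "I ((f ^^ k) X)"
  by (induction k) (use assms in auto)

lemma absorb_passes_invariant:
  assumes "I X" and "\<And>v X. v \<in> set vs \<Longrightarrow> I X \<Longrightarrow> I (absorb d E v X)"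
  shows "I ((absorb_pass d E vs ^^ k) X)"
  using assms by (intro funpow_invariant[of I]) (auto intro: absorb_pass_invariant)

text \<open>A fixed point persists once reached, and before it every application adds an element.
  Without one, \<open>k\<close> applications would add at least \<open>k\<close> elements, contrary
  to \<open>small\<close>.\<close>

lemma funpow_inflationary_fixpoint:
  fixes f :: "'a set \<Rightarrow> 'a set"
  assumes infl: "\<And>X. X \<subseteq> f X" and fin: "finite ((f ^^ k) X)"
    and small: "card ((f ^^ k) X) < card X + k"
  shows "f ((f ^^ k) X) = (f ^^ k) X"
proof (rule ccontr)
  assume ne: "f ((f ^^ k) X) \<noteq> (f ^^ k) X"
  have "j \<le> k \<Longrightarrow> finite ((f ^^ j) X) \<and> card X + j \<le> card ((f ^^ j) X)" for j
  proof (induction j)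
    case 0
    have "X \<subseteq> (f ^^ k) X"
      by (rule funpow_invariant) (use infl in blast)+
    then show ?case
      using fin finite_subset by auto
  next
    case (Suc j)
    have "f ((f ^^ j) X) \<noteq> (f ^^ j) X"
    proof
      assume fp: "f ((f ^^ j) X) = (f ^^ j) X"
      have "(f ^^ k) X = (f ^^ (k - j)) ((f ^^ j) X)"
        using Suc.prems by (metis Suc_leD add.commute funpow_add le_add_diff_inverse o_apply)
      also have "\<dots> = (f ^^ j) X"
        by (rule funpow_invariant) (use fp in auto)
      finally show False
        using fp ne by simp
    qed
    then have "(f ^^ j) X \<subset> (f ^^ Suc j) X"
      using infl by auto
    moreover have "(f ^^ Suc j) X \<subseteq> (f ^^ (k - Suc j)) ((f ^^ Suc j) X)"
      by (rule funpow_invariant) (use infl in blast)+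
    then have "(f ^^ Suc j) X \<subseteq> (f ^^ k) X"
      using Suc.prems by (metis add.commute funpow_add le_add_diff_inverse o_apply)
    then have "finite ((f ^^ Suc j) X)"
      using fin finite_subset by blast
    ultimately show ?case
      using Suc psubset_card_mono[of "(f ^^ Suc j) X" "(f ^^ j) X"] by simp
  qed
  from this[of k] show False
    using small by simp
qed

text \<open>A vertex of degree at most \<open>2 * d + 1\<close> that is absorbed into \<open>X\<close> removes at least \<open>d + 1\<close>
  edges from the cut and adds at most \<open>d\<close>, so this quantity does not increase.\<close>

definition size_plus_cut :: "'a set set \<Rightarrow> 'a set \<Rightarrow> nat" where
  "size_plus_cut E X = card X + (\<Sum>u\<in>X. card (neighbours E u - X))"

lemma size_plus_cut_absorb:
  assumes G: "simple_graph V E" and "finite X" and deg: "degree E v \<le> 2 * d + 1"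
  shows "size_plus_cut E (absorb d E v X) \<le> size_plus_cut E X"
proof (cases "d < card (neighbours E v \<inter> X) \<and> v \<notin> X")
  case True
  note fin = finite_neighbours[OF G]
  \<comment> \<open>Each neighbour of \<open>v\<close> loses exactly one outside neighbour, namely
    \<open>v\<close>; summed over \<open>X\<close> this is the number of neighbours of
    \<open>v\<close> in \<open>X\<close>.\<close>
  have "card (neighbours E u - X) =
      card (neighbours E u - insert v X) + (if u \<in> neighbours E v then 1 else 0)"
    for u
  proof (cases "u \<in> neighbours E v")
    case uv: True
    then have "v \<in> neighbours E u - X"
      using neighbours_sym[of u E v] True by simp
    moreover have "neighbours E u - insert v X = neighbours E u - X - {v}"
      by auto
    ultimately show ?thesis
      using uv fin[of u] card_Suc_Diff1[of "neighbours E u - X" v] by simp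
  next
    case False
    then have "neighbours E u - insert v X = neighbours E u - X"
      using neighbours_sym[of v E u] by auto
    then show ?thesis
      using False by simp
  qed
  then have "(\<Sum>u\<in>X. card (neighbours E u - X)) =
      (\<Sum>u\<in>X. card (neighbours E u - insert v X)) + (\<Sum>u\<in>X. if u \<in> neighbours E v then 1 else 0)"
    by (simp add: sum.distrib)
  also have "(\<Sum>u\<in>X. if u \<in> neighbours E v then 1 else 0) = card (neighbours E v \<inter> X)"
    using \<open>finite X\<close> by (simp add: sum.If_cases Int_commute)
  finally have "(\<Sum>u\<in>X. card (neighbours E u - X)) =
      (\<Sum>u\<in>X. card (neighbours E u - insert v X)) + card (neighbours E v \<inter> X)" .
  \<comment> \<open>New cut edges all start at \<open>v\<close>, and there are at most
    \<open>d\<close> of them. The \<open>d + 1\<close> or more edges lost also pay for the growth of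
    \<open>card X\<close> by one.\<close>
  moreover have "card (neighbours E v - insert v X) + card (neighbours E v \<inter> X) \<le> degree E v"
  proof -
    have "card (neighbours E v - insert v X) \<le> card (neighbours E v - X)"
      using fin by (intro card_mono) auto
    then show ?thesis
      using card_Int_Diff[of "neighbours E v" X] fin[of v] by (simp add: degree_def)
  qed
  ultimately show ?thesis
    using True \<open>finite X\<close> deg by (simp add: absorb_def size_plus_cut_def)
qed (auto simp: absorb_def insert_absorb)

text \<open>Suffices for both phases: the first can add only vertices of a closed neighbourhood, at
  most \<open>2 * d + 2\<close>; the second starts with at most \<open>2 * d + 2\<close> vertices
  and \<open>(2 * d + 2) * d\<close> cut edges, and each addition uses up a cut edge.\<close>

definition pass_count :: "nat \<Rightarrow> nat" where
  "pass_count d = (2 * d + 2) * (d + 1)"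

text \<open>\<open>A\<close> collects the vertices that cannot be kept in the closed neighbourhood of \<open>v\<close>. What remains
  contains the core and is then enlarged to \<open>B\<close>.\<close>

lemma absorb_passes_d_cut:
  assumes d: "d \<ge> 1" and G: "simple_graph V E" and claw: "claw_free V E"
    and deg: "\<And>u. u \<in> V \<Longrightarrow> degree E u \<le> 2 * d + 1"
    and large: "card V > (2 * d + 2) * (d + 1)"
    and v: "v \<in> V" and max: "\<And>u. u \<in> V \<Longrightarrow> degree E u \<le> degree E v"
    and vs: "set vs = V"
    and A: "A = (absorb_pass d E vs ^^ pass_count d) (V - insert v (neighbours E v))"
    and B: "B = (absorb_pass d E vs ^^ pass_count d) (V - A)"
  shows "d_cut d V E {e \<in> E. \<exists>b\<in>B. \<exists>r\<in>V - B. e = {b, r}}"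
proof -
  note fin = finite_neighbours[OF G] and sub = neighbours_subset[OF G]
  have finV: "finite V"
    using G by (simp add: simple_graph_def)
  have subV: "(absorb_pass d E vs ^^ k) X \<subseteq> V" if "X \<subseteq> V" for k X
    by (rule absorb_passes_invariant[where I = "\<lambda>Y. Y \<subseteq> V"]) (use that vs in \<open>auto simp: absorb_def\<close>)
  have superset: "X \<subseteq> (absorb_pass d E vs ^^ k) X" for k X
    by (rule absorb_passes_invariant[where I = "\<lambda>Y. X \<subseteq> Y"]) (auto simp: absorb_def)
  have split: "card (neighbours E c - X) + card (neighbours E c \<inter> X) = degree E c" for c X
    using fin[of c] unfolding degree_def by (subst card_Int_Diff[of _ X]) auto
  define D where "D = insert v (neighbours E v)"
  have D: "D \<subseteq> V" "finite D" "card D \<le> 2 * d + 2"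
    using v sub fin deg[OF v] card_insert_le_m1[of "2 * d + 2" "neighbours E v" v]
    by (auto simp: D_def degree_def)
  obtain C where C: "v \<in> C" "C \<subseteq> D" "\<And>c. c \<in> C \<Longrightarrow> card (neighbours E c - C) \<le> d"
    using claw_free_core[OF G claw deg v max] unfolding D_def by blast
  \<comment> \<open>A core vertex has at most \<open>d\<close> neighbours outside \<open>C\<close>,
    too few to be absorbed into a set disjoint from \<open>C\<close>.\<close>
  have "A \<inter> C = {}"
    unfolding A
  proof (rule absorb_passes_invariant[where I = "\<lambda>X. X \<inter> C = {}"])
    fix u X
    assume X: "X \<inter> C = {}"
    have "u \<notin> C" if "d < card (neighbours E u \<inter> X)"
    proof
      assume "u \<in> C"
      moreover have "card (neighbours E u \<inter> X) \<le> card (neighbours E u - C)"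
        using X fin by (intro card_mono) auto
      ultimately show False
        using C(3) that by fastforce
    qed
    then show "absorb d E u X \<inter> C = {}"
      using X by (auto simp: absorb_def)
  next
    show "(V - insert v (neighbours E v)) \<inter> C = {}"
      using C(2) by (auto simp: D_def)
  qed
  have AV: "A \<subseteq> V"
    unfolding A by (intro subV) auto
  have VD: "card V = card (V - D) + card D"
    using D finV by (metis card_Diff_subset card_mono le_add_diff_inverse2)
  \<comment> \<open>Only the vertices of \<open>D\<close> can be added, fewer than there are passes,
    so the iteration has stabilised.\<close>
  have "card A < card (V - D) + pass_count d"
  proof -
    have "card A \<le> card V"
      using AV finV by (simp add: card_mono)
    moreover have "card D < pass_count d"
      using D(3) d by (simp add: pass_count_def)
    ultimately show ?thesis
      using VD by linarith
  qed
  then have "absorb_pass d E vs A = A"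
    unfolding A D_def
    by (intro funpow_inflationary_fixpoint absorb_pass_mono)
      (use subV finV in \<open>meson Diff_subset finite_subset\<close>)
  then have closedA: "card (neighbours E u \<inter> A) \<le> d" if "u \<in> V - A" for u
    using that vs absorb_pass_closed by (metis DiffE)
  have cardVA: "V - A \<subseteq> D"
    using superset[of "V - D"] unfolding A D_def by auto
  have BV: "B \<subseteq> V"
    unfolding B by (intro subV) auto
  \<comment> \<open>A newly absorbed vertex has more than \<open>d\<close> of its at most
    \<open>2 * d + 1\<close> neighbours inside, so at most \<open>d\<close> outside; for older
    vertices the outside only shrinks.\<close>
  have "size_plus_cut E B \<le> size_plus_cut E (V - A) \<and> finite B \<and>
      (\<forall>u\<in>B. card (neighbours E u - B) \<le> d)"
    unfolding B
  proof (rule absorb_passes_invariant[where I = "\<lambda>X. size_plus_cut E X \<le> size_plus_cut E (V - A) \<and>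
        finite X \<and> (\<forall>u\<in>X. card (neighbours E u - X) \<le> d)"])
    fix u X
    assume u: "u \<in> set vs" and X: "size_plus_cut E X \<le> size_plus_cut E (V - A) \<and> finite X \<and>
      (\<forall>u\<in>X. card (neighbours E u - X) \<le> d)"
    have "size_plus_cut E (absorb d E u X) \<le> size_plus_cut E (V - A)"
      using size_plus_cut_absorb[OF G, of X u d] X u vs deg le_trans by blast
    moreover have "card (neighbours E w - absorb d E u X) \<le> d" if w: "w \<in> absorb d E u X" for w
    proof -
      have "card (neighbours E w - absorb d E u X) \<le> card (neighbours E w - X)"
        using fin by (intro card_mono) (auto simp: absorb_def)
      moreover have "card (neighbours E w - X) \<le> d"
      proof (cases "w \<in> X")
        case False
        then have "w = u" "d < card (neighbours E u \<inter> X)"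
          using w by (auto simp: absorb_def split: if_splits)
        then show ?thesis
          using split[of u X] deg[of u] u vs by simp
      qed (use X in auto)
      ultimately show ?thesis
        by simp
    qed
    moreover have "finite (absorb d E u X)"
      using X by (simp add: absorb_def)
    ultimately show "size_plus_cut E (absorb d E u X) \<le> size_plus_cut E (V - A) \<and>
        finite (absorb d E u X) \<and> (\<forall>w\<in>absorb d E u X. card (neighbours E w - absorb d E u X) \<le> d)"
      by blast
  next
    have "neighbours E u - (V - A) = neighbours E u \<inter> A" for u
      using sub by auto
    then show "size_plus_cut E (V - A) \<le> size_plus_cut E (V - A) \<and> finite (V - A) \<and>
        (\<forall>u\<in>V - A. card (neighbours E u - (V - A)) \<le> d)"
      using closedA finV by auto
  qed
  then have B1: "card B \<le> size_plus_cut E (V - A)"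
    and B2: "\<And>u. u \<in> B \<Longrightarrow> card (neighbours E u - B) \<le> d"
    by (auto simp: size_plus_cut_def)
  \<comment> \<open>Outside neighbours of \<open>V - A\<close> lie in \<open>A\<close>, and
    stability of \<open>A\<close> leaves each vertex at most \<open>d\<close> of them.\<close>
  have "size_plus_cut E (V - A) \<le> card (V - A) + card (V - A) * d"
  proof -
    have "neighbours E u - (V - A) = neighbours E u \<inter> A" for u
      using sub by auto
    then have "(\<Sum>u\<in>V - A. card (neighbours E u - (V - A))) \<le> (\<Sum>u\<in>V - A. d)"
      using closedA by (intro sum_mono) simp
    then show ?thesis
      by (simp add: size_plus_cut_def)
  qed
  moreover have VA: "card (V - A) \<le> 2 * d + 2"
    using card_mono[OF D(2) cardVA] D(3) by simp
  ultimately have cB: "card B \<le> card (V - A) + (2 * d + 2) * d"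
    using B1 mult_le_mono1[OF VA, of d] by linarith
  then have "card B < card (V - A) + pass_count d"
    using d by (simp add: pass_count_def)
  then have "absorb_pass d E vs B = B"
    unfolding B
    by (intro funpow_inflationary_fixpoint absorb_pass_mono)
      (use subV finV in \<open>meson Diff_subset finite_subset\<close>)
  then have closedB: "card (neighbours E u \<inter> B) \<le> d" if "u \<in> V - B" for u
    using that vs absorb_pass_closed by (metis DiffE)
  \<comment> \<open>\<open>B\<close> has at most \<open>(2 * d + 2) * (d + 1)\<close> vertices, so
    the other side is non-empty; \<open>B\<close> itself contains the core vertex
    \<open>v\<close>.\<close>
  have "card B < card V"
    using cB VA large by (simp add: algebra_simps)
  then have "V - B \<noteq> {}"
    using BV by auto
  moreover have "v \<in> B"
    using superset[of "V - A" "pass_count d"] \<open>A \<inter> C = {}\<close> C(1) v unfolding B by auto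
  moreover have "neighbours E u \<inter> (V - B) = neighbours E u - B" for u
    using sub by auto
  ultimately show ?thesis
    unfolding d_cut_def using BV B2 closedB
    by (intro exI[of _ B] exI[of _ "V - B"]) auto
qed

text \<open>Connects the size hypothesis of the theorem with the one of
  \<open>absorb_passes_d_cut\<close>.\<close>

lemma d_cut_size_bound:
  fixes d :: nat
  assumes "d \<ge> 2"
  shows "(2 * d + 2) * (d + 1) \<le> 4 * d ^ 2 * (2 * d + 1)"
proof -
  have "(2 * d + 2) * (d + 1) \<le> (4 * d) * (2 * d + 1)"
    using assms by (intro mult_le_mono) auto
  also have "\<dots> \<le> (4 * d ^ 2) * (2 * d + 1)"
    using assms by (intro mult_le_mono1) (simp add: power2_eq_square)
  finally show ?thesis .
qed

lemma d_cut_exists: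
  assumes d: "d \<ge> 2" and G: "simple_graph V E" and claw: "claw_free V E"
    and deg: "max_degree V E \<le> 2 * d + 1" and large: "card V > 4 * d ^ 2 * (2 * d + 1)"
  shows "\<exists>M. d_cut d V E M"
proof -
  have finV: "finite V" and "V \<noteq> {}"
    using G large by (auto simp: simple_graph_def)
  then have "max_degree V E \<in> degree E ` V"
    unfolding max_degree_def by (intro Max_in) auto
  then obtain v where v: "v \<in> V" "degree E v = max_degree V E"
    by auto
  have "degree E u \<le> degree E v" "degree E u \<le> 2 * d + 1" if "u \<in> V" for u
    using degree_le_max_degree[OF G that] v deg by auto
  moreover obtain vs where "set vs = V"
    using finV finite_list by blast
  moreover have "d \<ge> 1" "card V > (2 * d + 2) * (d + 1)"
    using d_cut_size_bound[OF d] large d by auto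
  ultimately show ?thesis
    using absorb_passes_d_cut[OF _ G claw _ _ v(1) _ _ refl refl, of d vs] by blast
qed

section \<open>A linear-time program\<close>

text \<open>The argument \<open>t\<close> is the time elapsed so far; \<open>Q\<close> constrains the final configuration together
  with the total elapsed time.\<close>

definition wp :: "nat \<Rightarrow> com \<Rightarrow> (config \<Rightarrow> nat \<Rightarrow> bool) \<Rightarrow> config \<Rightarrow> nat \<Rightarrow> bool" where
  "wp W c Q s t \<longleftrightarrow> (\<exists>u s'. exec W c s u s' \<and> Q s' (t + u))"

text \<open>Determinism turns the existential over executions into an equivalence, so the rules for
  instructions can serve as rewrite rules.\<close>

lemma wp_exec: "exec W c s u s' \<Longrightarrow> wp W c Q s t \<longleftrightarrow> Q s' (t + u)"
  unfolding wp_def using exec_deterministic by blast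

section \<open>Timed weakest-precondition rules\<close>

lemma wp_Const [simp]:
  "wp W (Const x k) Q s t \<longleftrightarrow> k \<le> W \<and> Q (s\<lparr>regs := (regs s)(x := k)\<rparr>) (t + 1)"
proof (cases "k \<le> W")
  case False
  then show ?thesis
    by (auto simp: wp_def elim: exec_ConstE)
qed (simp only: wp_exec[OF exec.Const] simp_thms)

lemma wp_Add [simp]:
  "wp W (Add x y z) Q s t \<longleftrightarrow>
     regs s y + regs s z \<le> W \<and> Q (s\<lparr>regs := (regs s)(x := regs s y + regs s z)\<rparr>) (t + 1)"
proof (cases "regs s y + regs s z \<le> W")
  case False
  then show ?thesis
    by (auto simp: wp_def elim: exec_AddE)
qed (simp only: wp_exec[OF exec.Add] simp_thms)

lemma wp_Sub [simp]:
  "wp W (Sub x y z) Q s t \<longleftrightarrow> Q (s\<lparr>regs := (regs s)(x := regs s y - regs s z)\<rparr>) (t + 1)"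
  by (rule wp_exec[OF exec.Sub])

lemma wp_Load [simp]:
  "wp W (Load x y) Q s t \<longleftrightarrow> Q (s\<lparr>regs := (regs s)(x := memory s (regs s y))\<rparr>) (t + 1)"
  by (rule wp_exec[OF exec.Load])

lemma wp_Store [simp]:
  "wp W (Store x y) Q s t \<longleftrightarrow> Q (s\<lparr>memory := (memory s)(regs s x := regs s y)\<rparr>) (t + 1)"
  by (rule wp_exec[OF exec.Store])

lemma wp_Print [simp]:
  "wp W (Print x) Q s t \<longleftrightarrow> Q (s\<lparr>printed := printed s @ [regs s x]\<rparr>) (t + 1)"
  by (rule wp_exec[OF exec.Print])

lemma wp_Seq [simp]: "wp W (Seq c1 c2) Q s t \<longleftrightarrow> wp W c1 (wp W c2 Q) s t"
proof
  assume "wp W (Seq c1 c2) Q s t"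
  then show "wp W c1 (wp W c2 Q) s t"
    unfolding wp_def by (metis add.assoc exec_SeqE)
next
  assume "wp W c1 (wp W c2 Q) s t"
  then show "wp W (Seq c1 c2) Q s t"
    unfolding wp_def by (metis add.assoc exec.Seq)
qed

lemma wp_IfLess [simp]:
  "wp W (IfLess x y c1 c2) Q s t \<longleftrightarrow>
     (if regs s x < regs s y then wp W c1 Q s (t + 1) else wp W c2 Q s (t + 1))"
proof -
  have "exec W (IfLess x y c1 c2) s u s' \<longleftrightarrow>
      (\<exists>u'. u = 1 + u' \<and> exec W (if regs s x < regs s y then c1 else c2) s u' s')" for u s'
    by (auto elim: exec_IfE intro: exec.IfTrue[simplified] exec.IfFalse[simplified])
  then show ?thesis
    unfolding wp_def by (cases "regs s x < regs s y") (simp_all, (metis add_Suc_right)+)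
qed

lemma wp_mono: "wp W c Q s t \<Longrightarrow> (\<And>s' t'. Q s' t' \<Longrightarrow> Q' s' t') \<Longrightarrow> wp W c Q' s t"
  unfolding wp_def by blast

text \<open>The gap between the two registers is the termination measure. The invariant may mention
  elapsed time, so one rule yields correctness and running time; every test, the failing one
  included, costs one unit.\<close>

lemma wp_WhileLess:
  assumes "I s t"
    and "\<And>s t. I s t \<Longrightarrow> regs s x < regs s y \<Longrightarrow>
      wp W c (\<lambda>s' t'. I s' t' \<and> regs s' y - regs s' x < regs s y - regs s x) s (t + 1)"
    and "\<And>s t. I s t \<Longrightarrow> \<not> regs s x < regs s y \<Longrightarrow> Q s (t + 1)"
  shows "wp W (WhileLess x y c) Q s t"
  using assms(1)
proof (induction "regs s y - regs s x" arbitrary: s t rule: less_induct)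
  case less
  show ?case
  proof (cases "regs s x < regs s y")
    case True
    obtain u s' where c: "exec W c s u s'" "I s' (t + 1 + u)"
      "regs s' y - regs s' x < regs s y - regs s x"
      using assms(2)[OF less.prems True] unfolding wp_def by auto
    obtain u' s'' where "exec W (WhileLess x y c) s' u' s''" "Q s'' (t + 1 + u + u')"
      using less.hyps[OF c(3,2)] unfolding wp_def by auto
    then show ?thesis
      using exec.WhileTrue[OF True c(1)] unfolding wp_def by (metis add.assoc)
  next
    case False
    then show ?thesis
      using assms(3)[OF less.prems] exec.WhileFalse unfolding wp_def by blast
  qed
qed

text \<open>The loop is unrolled, as its count depends on \<open>d\<close> alone.
  \<open>Sub 10 0 0\<close> stands in for a skip instruction: it only clears a scratch
  register.\<close>

fun repeat :: "nat \<Rightarrow> com \<Rightarrow> com" where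
  "repeat 0 c = Sub 10 0 0"
| "repeat (Suc k) c = Seq c (repeat k c)"

text \<open>Registers: 0, 2, 3, 4, 13 hold the constants \<open>0\<close>, \<open>1\<close>, \<open>n\<close>, the first free address and \<open>d\<close>;
  5 is the current vertex, 6 to 8 are the position in its adjacency list, the end
  of that list and the current neighbour; 9 and 10 are scratch; 11 and 12 are the
  best vertex and its degree.\<close>

definition for_vertices :: "com \<Rightarrow> com" where
  "for_vertices c = Seq (Const 5 0) (WhileLess 5 3 (Seq c (Add 5 5 2)))"

definition for_neighbours :: "com \<Rightarrow> com" where
  "for_neighbours c =
     Seq (Add 6 5 2) (Seq (Add 7 6 2) (Seq (Load 6 6) (Seq (Load 7 7)
       (WhileLess 6 7 (Seq (Load 8 6) (Seq c (Add 6 6 2)))))))"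

text \<open>Register 0 is initially 0, so \<open>Load 3 0\<close> reads \<open>n\<close> from cell
  0. Cell \<open>n + 1\<close> holds the end of the last list, where the marks are to begin.\<close>

definition prepare :: "nat \<Rightarrow> com" where
  "prepare d = Seq (Const 2 1) (Seq (Const 13 d) (Seq (Load 3 0) (Seq (Add 4 3 2) (Load 4 4))))"

text \<open>A degree is the difference of two consecutive list addresses.\<close>

definition find_max_degree :: com where
  "find_max_degree = for_vertices
     (Seq (Add 10 5 2) (Seq (Add 9 10 2) (Seq (Load 10 10) (Seq (Load 9 9) (Seq (Sub 9 9 10)
       (IfLess 12 9 (Seq (Add 12 9 0) (Add 11 5 0)) (Sub 10 0 0)))))))"

definition mark_closed_neighbourhood :: com where
  "mark_closed_neighbourhood =
     Seq (Add 5 11 0) (Seq (Add 10 4 5) (Seq (Store 10 2)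
       (for_neighbours (Seq (Add 10 4 8) (Store 10 2)))))"

text \<open>Marks are 0 or 1, so subtraction from 1 flips them.\<close>

definition complement_marks :: com where
  "complement_marks = for_vertices
     (Seq (Add 10 4 5) (Seq (Load 9 10) (Seq (Sub 9 2 9) (Store 10 9))))"

text \<open>Summing the marks along an adjacency list counts the marked neighbours.\<close>

definition absorb_marks :: com where
  "absorb_marks = for_vertices
     (Seq (Sub 9 0 0) (Seq (for_neighbours (Seq (Add 10 4 8) (Seq (Load 10 10) (Add 9 9 10))))
       (IfLess 13 9 (Seq (Add 10 4 5) (Store 10 2)) (Sub 10 0 0))))"

text \<open>Only the lists of marked vertices are scanned, so each cut edge is printed once, from
  its marked end.\<close>

definition print_cut :: com where
  "print_cut = for_vertices
     (Seq (Add 10 4 5) (Seq (Load 9 10) (IfLess 0 9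
       (for_neighbours (Seq (Add 10 4 8) (Seq (Load 10 10)
          (IfLess 10 2 (Seq (Print 5) (Print 8)) (Sub 10 0 0)))))
       (Sub 10 0 0))))"

text \<open>The marks describe in turn the closed neighbourhood of the best vertex, its complement,
  the set \<open>A\<close> of \<open>absorb_passes_d_cut\<close>, the complement of
  \<open>A\<close>, and \<open>B\<close>.\<close>

definition d_cut_program :: "nat \<Rightarrow> com" where
  "d_cut_program d =
     Seq (prepare d) (Seq find_max_degree (Seq mark_closed_neighbourhood
       (Seq complement_marks (Seq (repeat (pass_count d) absorb_marks)
         (Seq complement_marks (Seq (repeat (pass_count d) absorb_marks) print_cut))))))"

section \<open>Addresses in the encoded graph\<close>

definition list_address :: "nat list list \<Rightarrow> nat \<Rightarrow> nat" where
  "list_address adj v = length adj + 2 + length (concat (take v adj))"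

lemma list_address_Suc:
  "v < length adj \<Longrightarrow> list_address adj (Suc v) = list_address adj v + length (adj ! v)"
  by (simp add: list_address_def take_Suc_conv_app_nth)

lemma list_address_le: "list_address adj v \<le> list_address adj (length adj)"
  by (simp add: list_address_def)
    (metis append_take_drop_id concat_append le_add1 length_append)

lemma length_encode_graph: "length (encode_graph adj) = list_address adj (length adj)"
  by (simp add: encode_graph_def list_address_def)

lemma encode_graph_list_address:
  "v \<le> length adj \<Longrightarrow> encode_graph adj ! Suc v = list_address adj v"
  by (simp add: encode_graph_def list_address_def nth_append del: upt_Suc)

lemma encode_graph_neighbour:
  assumes "v < length adj" "j < length (adj ! v)"
  shows "encode_graph adj ! (list_address adj v + j) = adj ! v ! j"
proof -
  have "concat adj = concat (take v adj) @ adj ! v @ concat (drop (Suc v) adj)"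
    using id_take_nth_drop[OF assms(1)] by (metis concat.simps(2) concat_append)
  then have "concat adj ! (length (concat (take v adj)) + j) = adj ! v ! j"
    using assms(2) by (simp add: nth_append)
  then show ?thesis
    by (simp add: encode_graph_def list_address_def nth_append del: upt_Suc)
qed

text \<open>\<open>word_size\<close> makes room for the addresses of the input and of
  \<open>n\<close> mark cells behind it, and for the constant \<open>d\<close>.\<close>

locale graph_input =
  fixes n d W :: nat and adj :: "nat list list"
  assumes length_adj: "length adj = n"
    and adj_less: "\<And>v u. v < n \<Longrightarrow> u \<in> set (adj ! v) \<Longrightarrow> u < n"
    and n_pos: "0 < n"
    and word_size: "list_address adj n + n \<le> W" "d \<le> W"
begin

abbreviation "addr \<equiv> list_address adj"

definition free :: nat where
  "free = addr n"

text \<open>Describes the whole memory: the input stays intact and \<open>X\<close> is the only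
  variable part, so each phase can be specified as a transformation of sets.\<close>

definition marked :: "nat set \<Rightarrow> nat \<Rightarrow> nat" where
  "marked X i = (if i < free then encode_graph adj ! i else if i - free \<in> X then 1 else 0)"

definition ready :: "config \<Rightarrow> bool" where
  "ready s \<longleftrightarrow> regs s 0 = 0 \<and> regs s 2 = 1 \<and> regs s 3 = n \<and> regs s 4 = free \<and> regs s 13 = d"

text \<open>Bounds one loop over the vertices: a body takes at most 9 units per vertex and 9 per
  list entry, and test and increment add 2 per vertex.\<close>

definition scan_time :: nat where
  "scan_time = 11 * (n + free)"

lemma addr_le: "addr v \<le> free"
  using list_address_le[of adj v] by (simp add: free_def length_adj)

lemma addr_Suc: "v < n \<Longrightarrow> addr (Suc v) = addr v + length (adj ! v)"
  by (simp add: list_address_Suc length_adj)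

lemma free_bounds: "n + 2 \<le> free" "free + n \<le> W"
  using word_size length_adj by (auto simp: free_def list_address_def)

lemma marked_0: "marked X 0 = n"
  using free_bounds by (simp add: marked_def encode_graph_def length_adj)

lemma marked_addr: "v \<le> n \<Longrightarrow> marked X (Suc v) = addr v"
  using free_bounds encode_graph_list_address[of v adj] by (simp add: marked_def length_adj)

lemma marked_neighbour:
  assumes "v < n" "j < length (adj ! v)"
  shows "marked X (addr v + j) = adj ! v ! j"
proof -
  have "addr v + j < free"
    using addr_Suc[OF assms(1)] addr_le[of "Suc v"] assms(2) by linarith
  then show ?thesis
    using encode_graph_neighbour[of v adj j] assms by (simp add: marked_def length_adj)
qed

lemma marked_vertex: "marked X (free + v) = (if v \<in> X then 1 else 0)"
  by (simp add: marked_def)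

lemma marked_insert: "(marked X)(free + v := Suc 0) = marked (insert v X)"
  by (auto simp: marked_def fun_eq_iff)

lemma marked_remove: "(marked X)(free + v := 0) = marked (X - {v})"
  by (auto simp: marked_def fun_eq_iff)

text \<open>By \<open>frame\<close> the invariant ignores the loop counter and survives its
  increment. The list lengths in the time bounds of the bodies telescope into addresses.\<close>

lemma wp_for_vertices:
  assumes init: "ready s" "I 0 s"
    and frame: "\<And>v s s'. I v s \<Longrightarrow> memory s' = memory s \<Longrightarrow> printed s' = printed s \<Longrightarrow>
      (\<And>r. r \<noteq> 5 \<Longrightarrow> regs s' r = regs s r) \<Longrightarrow> I v s'"
    and body: "\<And>v s t. v < n \<Longrightarrow> ready s \<Longrightarrow> regs s 5 = v \<Longrightarrow> I v s \<Longrightarrow>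
      wp W c (\<lambda>s' t'. ready s' \<and> regs s' 5 = v \<and> I (Suc v) s' \<and>
        t' \<le> t + 9 * (1 + length (adj ! v))) s t"
    and post: "\<And>s' t'. ready s' \<Longrightarrow> I n s' \<Longrightarrow> t' \<le> t + scan_time \<Longrightarrow> Q s' t'"
  shows "wp W (for_vertices c) Q s t"
proof -
  define J where "J s' t' \<longleftrightarrow> ready s' \<and> regs s' 5 \<le> n \<and> I (regs s' 5) s' \<and>
    t' \<le> t + 1 + 11 * regs s' 5 + 9 * addr (regs s' 5)" for s' t'
  have "wp W (WhileLess 5 3 (Seq c (Add 5 5 2))) Q (s\<lparr>regs := (regs s)(5 := 0)\<rparr>) (t + 1)"
  proof (rule wp_WhileLess[where I = J])
    have "I 0 (s\<lparr>regs := (regs s)(5 := 0)\<rparr>)"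
      by (rule frame[of 0 s]) (use init in auto)
    then show "J (s\<lparr>regs := (regs s)(5 := 0)\<rparr>) (t + 1)"
      using init by (simp add: J_def ready_def)
  next
    fix s' t'
    assume J: "J s' t'" and less: "regs s' 5 < regs s' 3"
    let ?v = "regs s' 5"
    have v: "?v < n" and r: "ready s'" and I: "I ?v s'"
      using J less by (auto simp: J_def ready_def)
    show "wp W (Seq c (Add 5 5 2)) (\<lambda>s'' t''. J s'' t'' \<and> regs s'' 3 - regs s'' 5 < regs s' 3 - regs s' 5)
      s' (t' + 1)"
      unfolding wp_Seq
    proof (rule wp_mono[OF body[OF v r refl I]])
      fix s1 t1
      assume 1: "ready s1 \<and> regs s1 5 = ?v \<and> I (Suc ?v) s1 \<and>
        t1 \<le> t' + 1 + 9 * (1 + length (adj ! ?v))"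
      define s2 where "s2 = s1\<lparr>regs := (regs s1)(5 := Suc ?v)\<rparr>"
      have "I (Suc ?v) s2"
        by (rule frame[of "Suc ?v" s1]) (use 1 in \<open>auto simp: s2_def\<close>)
      moreover have "t1 + 1 \<le> t + 1 + 11 * Suc ?v + 9 * addr (Suc ?v)"
        using 1 J addr_Suc[OF v] by (simp add: J_def)
      ultimately have "J s2 (t1 + 1)"
        using 1 v by (simp add: J_def ready_def s2_def)
      then show "wp W (Add 5 5 2) (\<lambda>s'' t''. J s'' t'' \<and>
          regs s'' 3 - regs s'' 5 < regs s' 3 - regs s' 5) s1 t1"
        using 1 v r free_bounds by (simp add: ready_def s2_def)
    qed
  next
    fix s' t'
    assume J: "J s' t'" and "\<not> regs s' 5 < regs s' 3"
    then have "regs s' 5 = n"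
      by (simp add: J_def ready_def)
    then show "Q s' (t' + 1)"
      using J free_bounds by (intro post) (auto simp: J_def scan_time_def free_def)
  qed
  then show ?thesis
    by (simp add: for_vertices_def)
qed

text \<open>\<open>mem\<close> keeps the input readable during the loop. Each entry costs 5 units
  for the body and 3 for test, load and increment; set-up and last test cost 5.\<close>

lemma wp_for_neighbours:
  assumes v: "v < n" and init: "ready s" "regs s 5 = v" "J 0 s"
    and frame: "\<And>j s s'. J j s \<Longrightarrow> memory s' = memory s \<Longrightarrow> printed s' = printed s \<Longrightarrow>
      (\<And>r. r \<noteq> 6 \<Longrightarrow> r \<noteq> 7 \<Longrightarrow> r \<noteq> 8 \<Longrightarrow> regs s' r = regs s r) \<Longrightarrow> J j s'"
    and mem: "\<And>j s. J j s \<Longrightarrow> \<exists>X. memory s = marked X"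
    and body: "\<And>j s t. j < length (adj ! v) \<Longrightarrow> ready s \<Longrightarrow> regs s 5 = v \<Longrightarrow>
      regs s 8 = adj ! v ! j \<Longrightarrow> J j s \<Longrightarrow>
      wp W c (\<lambda>s' t'. ready s' \<and> regs s' 5 = v \<and> regs s' 6 = regs s 6 \<and> regs s' 7 = regs s 7 \<and>
        J (Suc j) s' \<and> t' \<le> t + 5) s t"
    and post: "\<And>s' t'. ready s' \<Longrightarrow> regs s' 5 = v \<Longrightarrow> J (length (adj ! v)) s' \<Longrightarrow>
      t' \<le> t + 5 + 8 * length (adj ! v) \<Longrightarrow> Q s' t'"
  shows "wp W (for_neighbours c) Q s t"
proof -
  have last: "addr v + length (adj ! v) \<le> free"
    using addr_Suc[OF v] addr_le[of "Suc v"] by simp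
  define I where "I s' t' \<longleftrightarrow> (\<exists>j \<le> length (adj ! v). ready s' \<and> regs s' 5 = v \<and>
    regs s' 6 = addr v + j \<and> regs s' 7 = addr v + length (adj ! v) \<and> J j s' \<and>
    t' \<le> t + 4 + 8 * j)" for s' t'
  have "wp W (WhileLess 6 7 (Seq (Load 8 6) (Seq c (Add 6 6 2)))) Q
      (s\<lparr>regs := (regs s)(6 := addr v, 7 := addr v + length (adj ! v))\<rparr>) (t + 4)"
  proof (rule wp_WhileLess[where I = I])
    have "J 0 (s\<lparr>regs := (regs s)(6 := addr v, 7 := addr v + length (adj ! v))\<rparr>)"
      by (rule frame[of 0 s]) (use init in auto)
    then show "I (s\<lparr>regs := (regs s)(6 := addr v, 7 := addr v + length (adj ! v))\<rparr>) (t + 4)"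
      using init by (auto simp: I_def ready_def)
  next
    fix s' t'
    assume I: "I s' t'" and less: "regs s' 6 < regs s' 7"
    then obtain j where j: "j < length (adj ! v)" "ready s'" "regs s' 5 = v" "regs s' 6 = addr v + j"
      "regs s' 7 = addr v + length (adj ! v)" "J j s'" "t' \<le> t + 4 + 8 * j"
      unfolding I_def by auto
    define s0 where "s0 = s'\<lparr>regs := (regs s')(8 := memory s' (addr v + j))\<rparr>"
    have "memory s' (addr v + j) = adj ! v ! j"
      using mem[OF j(6)] marked_neighbour[OF v j(1)] by auto
    moreover have "J j s0"
      by (rule frame[of j s']) (use j in \<open>auto simp: s0_def\<close>)
    ultimately have s0: "ready s0" "regs s0 5 = v" "regs s0 8 = adj ! v ! j" "J j s0"
      "regs s0 6 = addr v + j" "regs s0 7 = addr v + length (adj ! v)"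
      using j by (auto simp: s0_def ready_def)
    have "wp W c (wp W (Add 6 6 2) (\<lambda>s'' t''. I s'' t'' \<and>
        regs s'' 7 - regs s'' 6 < regs s' 7 - regs s' 6)) s0 (t' + 2)"
    proof (rule wp_mono[OF body[OF j(1) s0(1-4)]])
      fix s1 t1
      assume 1: "ready s1 \<and> regs s1 5 = v \<and> regs s1 6 = regs s0 6 \<and> regs s1 7 = regs s0 7 \<and>
        J (Suc j) s1 \<and> t1 \<le> t' + 2 + 5"
      define s2 where "s2 = s1\<lparr>regs := (regs s1)(6 := Suc (addr v + j))\<rparr>"
      have "J (Suc j) s2"
        by (rule frame[of "Suc j" s1]) (use 1 in \<open>auto simp: s2_def\<close>)
      then have "I s2 (t1 + 1)"
        using 1 j s0 unfolding I_def by (intro exI[of _ "Suc j"]) (auto simp: ready_def s2_def)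
      then show "wp W (Add 6 6 2) (\<lambda>s'' t''. I s'' t'' \<and>
          regs s'' 7 - regs s'' 6 < regs s' 7 - regs s' 6) s1 t1"
        using 1 j s0 last free_bounds by (simp add: ready_def s2_def)
    qed
    then show "wp W (Seq (Load 8 6) (Seq c (Add 6 6 2))) (\<lambda>s'' t''. I s'' t'' \<and>
        regs s'' 7 - regs s'' 6 < regs s' 7 - regs s' 6) s' (t' + 1)"
      using j(4) by (simp add: s0_def)
  next
    fix s' t'
    assume "I s' t'" and "\<not> regs s' 6 < regs s' 7"
    then show "Q s' (t' + 1)"
      unfolding I_def by (intro post) auto
  qed
  moreover have "memory s (Suc v) = addr v" "memory s (Suc (Suc v)) = addr v + length (adj ! v)"
    using mem[OF init(3)] marked_addr[of v] marked_addr[of "Suc v"] v addr_Suc[OF v] by auto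
  ultimately show ?thesis
    using init v free_bounds
    by (simp add: for_neighbours_def ready_def eval_nat_numeral)
qed

section \<open>Correctness and running time of the phases\<close>

lemma wp_prepare:
  assumes "s = initial_config (encode_graph adj)"
    and post: "\<And>s' t'. ready s' \<Longrightarrow> memory s' = marked {} \<Longrightarrow> printed s' = [] \<Longrightarrow> regs s' 11 = 0 \<Longrightarrow>
      regs s' 12 = 0 \<Longrightarrow> t' \<le> t + 5 \<Longrightarrow> Q s' t'"
  shows "wp W (prepare d) Q s t"
proof -
  have mem: "memory s = marked {}"
    using assms(1) length_encode_graph[of adj]
    by (auto simp: initial_config_def marked_def free_def length_adj fun_eq_iff)
  have "regs s = (\<lambda>_. 0)" "printed s = []"
    using assms(1) by (auto simp: initial_config_def)
  moreover have "marked {} (Suc n) = free"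
    using marked_addr[of n] by (simp add: free_def)
  ultimately show ?thesis
    using mem word_size(2) free_bounds n_pos
    by (auto simp: prepare_def marked_0 ready_def intro!: post)
qed

lemma wp_find_max_degree:
  assumes s: "ready s" "memory s = marked X" "printed s = ys" "regs s 11 = 0" "regs s 12 = 0"
    and post: "\<And>s' t'. ready s' \<Longrightarrow> memory s' = marked X \<Longrightarrow> printed s' = ys \<Longrightarrow> regs s' 11 < n \<Longrightarrow>
      (\<And>w. w < n \<Longrightarrow> length (adj ! w) \<le> length (adj ! (regs s' 11))) \<Longrightarrow> t' \<le> t + scan_time \<Longrightarrow>
      Q s' t'"
  shows "wp W find_max_degree Q s t"
proof -
  \<comment> \<open>Register 12 need only be a lower bound for the degree of the best vertex, which
    holds initially for vertex 0 with value 0.\<close>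
  define I where "I v s' \<longleftrightarrow> memory s' = marked X \<and> printed s' = ys \<and> regs s' 11 < n \<and>
    regs s' 12 \<le> length (adj ! (regs s' 11)) \<and> (\<forall>w<v. length (adj ! w) \<le> regs s' 12)" for v and s' :: config
  show ?thesis
    unfolding find_max_degree_def
  proof (rule wp_for_vertices[where I = I])
    show "I 0 s"
      using s n_pos by (simp add: I_def)
  next
    fix v s' t'
    assume "v < n" "ready s'" "regs s' 5 = v" "I v s'"
    then show "wp W
         (Seq (Add 10 5 2) (Seq (Add 9 10 2) (Seq (Load 10 10) (Seq (Load 9 9) (Seq (Sub 9 9 10)
           (IfLess 12 9 (Seq (Add 12 9 0) (Add 11 5 0)) (Sub 10 0 0)))))))
         (\<lambda>s'' t''. ready s'' \<and> regs s'' 5 = v \<and> I (Suc v) s'' \<and>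
           t'' \<le> t' + 9 * (1 + length (adj ! v))) s' t'"
      using free_bounds addr_le[of "Suc v"] addr_Suc[of v] marked_addr[of v X] marked_addr[of "Suc v" X]
      by (auto simp: I_def ready_def less_Suc_eq)
  next
    fix s' t'
    assume "ready s'" "I n s'" "t' \<le> t + scan_time"
    then show "Q s' t'"
      by (intro post) (auto simp: I_def dest: order_trans)
  qed (use s in \<open>auto simp: I_def\<close>)
qed

lemma wp_mark_closed_neighbourhood:
  assumes s: "ready s" "memory s = marked X" "printed s = ys" "regs s 11 = v" and v: "v < n"
    and post: "\<And>s' t'. ready s' \<Longrightarrow> memory s' = marked (insert v (X \<union> set (adj ! v))) \<Longrightarrow>
      printed s' = ys \<Longrightarrow> t' \<le> t + scan_time \<Longrightarrow> Q s' t'"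
  shows "wp W mark_closed_neighbourhood Q s t"
proof -
  define s0 where "s0 = s\<lparr>regs := (regs s)(5 := v, 10 := free + v), memory := marked (insert v X)\<rparr>"
  define J where "J j s' \<longleftrightarrow> memory s' = marked (insert v (X \<union> set (take j (adj ! v)))) \<and>
    printed s' = ys" for j and s' :: config
  have "wp W (for_neighbours (Seq (Add 10 4 8) (Store 10 2))) Q s0 (t + 3)"
  proof (rule wp_for_neighbours[where J = J, OF v])
    fix j s' t'
    assume j: "j < length (adj ! v)" and s': "ready s'" "regs s' 5 = v" "regs s' 8 = adj ! v ! j" "J j s'"
    have "adj ! v ! j < n"
      using adj_less[OF v nth_mem[OF j]] .
    then show "wp W (Seq (Add 10 4 8) (Store 10 2)) (\<lambda>s'' t''. ready s'' \<and> regs s'' 5 = v \<and>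
        regs s'' 6 = regs s' 6 \<and> regs s'' 7 = regs s' 7 \<and> J (Suc j) s'' \<and> t'' \<le> t' + 5) s' t'"
      using s' j free_bounds
      by (simp add: J_def ready_def marked_insert take_Suc_conv_app_nth insert_commute)
  next
    fix s' t'
    assume s': "ready s'" "J (length (adj ! v)) s'" "t' \<le> t + 3 + 5 + 8 * length (adj ! v)"
    moreover have "length (adj ! v) \<le> free"
      using addr_Suc[OF v] addr_le[of "Suc v"] by simp
    ultimately show "Q s' t'"
      using free_bounds n_pos by (intro post) (auto simp: J_def scan_time_def)
  qed (use s in \<open>auto simp: J_def s0_def ready_def\<close>)
  then show ?thesis
    using s v free_bounds
    by (simp add: mark_closed_neighbourhood_def ready_def s0_def marked_insert eval_nat_numeral)
qed

lemma wp_complement_marks: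
  assumes s: "ready s" "memory s = marked X" "printed s = ys" and X: "X \<subseteq> {..<n}"
    and post: "\<And>s' t'. ready s' \<Longrightarrow> memory s' = marked ({..<n} - X) \<Longrightarrow> printed s' = ys \<Longrightarrow>
      t' \<le> t + scan_time \<Longrightarrow> Q s' t'"
  shows "wp W complement_marks Q s t"
proof -
  \<comment> \<open>Marks below \<open>v\<close> have been flipped already, the others not
    yet.\<close>
  define F where "F v = {w. w < v \<and> w \<notin> X \<or> v \<le> w \<and> w \<in> X}" for v
  define I where "I v s' \<longleftrightarrow> memory s' = marked (F v) \<and> printed s' = ys" for v and s' :: config
  have F: "F (Suc v) = (if v \<in> F v then F v - {v} else insert v (F v))" for v
    by (auto simp: F_def not_less_eq_eq less_Suc_eq Suc_le_eq)
  show ?thesis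
    unfolding complement_marks_def
  proof (rule wp_for_vertices[where I = I])
    have "F 0 = X"
      by (auto simp: F_def)
    then show "I 0 s"
      using s by (simp add: I_def)
  next
    fix v s' t'
    assume "v < n" "ready s'" "regs s' 5 = v" "I v s'"
    then show "wp W (Seq (Add 10 4 5) (Seq (Load 9 10) (Seq (Sub 9 2 9) (Store 10 9))))
         (\<lambda>s'' t''. ready s'' \<and> regs s'' 5 = v \<and> I (Suc v) s'' \<and>
           t'' \<le> t' + 9 * (1 + length (adj ! v))) s' t'"
      using free_bounds
      by (simp add: I_def F ready_def marked_vertex marked_insert marked_remove)
  next
    fix s' t'
    assume "ready s'" "I n s'" "t' \<le> t + scan_time"
    moreover have "F n = {..<n} - X"
      using X by (auto simp: F_def)
    ultimately show "Q s' t'"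
      by (intro post) (auto simp: I_def)
  qed (use s in \<open>auto simp: I_def\<close>)
qed

end

section \<open>Phases whose meaning depends on the edge set\<close>

locale adjacency_input = graph_input +
  fixes E :: "nat set set"
  assumes adjacency: "adjacency_lists n E adj"
begin

lemma neighbours_adj: "v < n \<Longrightarrow> neighbours E v = set (adj ! v)"
  and distinct_adj: "v < n \<Longrightarrow> distinct (adj ! v)"
  using adjacency by (auto simp: adjacency_lists_def)

lemma wp_absorb_marks:
  assumes s: "ready s" "memory s = marked X" "printed s = ys"
    and post: "\<And>s' t'. ready s' \<Longrightarrow> memory s' = marked (absorb_pass d E [0..<n] X) \<Longrightarrow>
      printed s' = ys \<Longrightarrow> t' \<le> t + scan_time \<Longrightarrow> Q s' t'"
  shows "wp W absorb_marks Q s t"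
proof -
  define F where "F v = absorb_pass d E [0..<v] X" for v
  define I where "I v s' \<longleftrightarrow> memory s' = marked (F v) \<and> printed s' = ys" for v and s' :: config
  show ?thesis
    unfolding absorb_marks_def
  proof (rule wp_for_vertices[where I = I])
    show "I 0 s"
      using s by (simp add: I_def F_def absorb_pass_def)
  next
    fix v s' t'
    assume v: "v < n" and s': "ready s'" "regs s' 5 = v" "I v s'"
    \<comment> \<open>Register 9 adds up marks; as the list has no repetitions, this sum is the
      cardinality tested by \<open>absorb\<close>.\<close>
    define J where "J j s'' \<longleftrightarrow> memory s'' = marked (F v) \<and> printed s'' = ys \<and>
      regs s'' 9 = card (set (take j (adj ! v)) \<inter> F v)" for j and s'' :: config
    have len: "length (adj ! v) \<le> free"
      using addr_Suc[OF v] addr_le[of "Suc v"] by simp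
    have "wp W (for_neighbours (Seq (Add 10 4 8) (Seq (Load 10 10) (Add 9 9 10))))
        (wp W (IfLess 13 9 (Seq (Add 10 4 5) (Store 10 2)) (Sub 10 0 0)) (\<lambda>s'' t''. ready s'' \<and>
          regs s'' 5 = v \<and> I (Suc v) s'' \<and> t'' \<le> t' + 9 * (1 + length (adj ! v))))
        (s'\<lparr>regs := (regs s')(9 := 0)\<rparr>) (t' + 1)"
    proof (rule wp_for_neighbours[where J = J, OF v])
      fix j s1 t1
      assume j: "j < length (adj ! v)"
        and s1: "ready s1" "regs s1 5 = v" "regs s1 8 = adj ! v ! j" "J j s1"
      have "adj ! v ! j < n"
        using adj_less[OF v nth_mem[OF j]] .
      moreover have "adj ! v ! j \<notin> set (take j (adj ! v))"
        using distinct_adj[OF v] j by (auto simp: in_set_conv_nth nth_eq_iff_index_eq)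
      moreover have "card (set (take j (adj ! v)) \<inter> F v) \<le> j"
        using card_mono[of "set (take j (adj ! v))" "set (take j (adj ! v)) \<inter> F v"]
          card_length[of "take j (adj ! v)"] by simp
      ultimately show "wp W (Seq (Add 10 4 8) (Seq (Load 10 10) (Add 9 9 10)))
          (\<lambda>s'' t''. ready s'' \<and> regs s'' 5 = v \<and> regs s'' 6 = regs s1 6 \<and> regs s'' 7 = regs s1 7 \<and>
            J (Suc j) s'' \<and> t'' \<le> t1 + 5) s1 t1"
        using s1 j len free_bounds
        by (simp add: J_def ready_def marked_vertex take_Suc_conv_app_nth)
    next
      fix s1 t1
      assume s1: "ready s1" "regs s1 5 = v" "J (length (adj ! v)) s1"
        "t1 \<le> t' + 1 + 5 + 8 * length (adj ! v)"
      moreover have "F (Suc v) = (if d < card (set (adj ! v) \<inter> F v) then insert v (F v) else F v)"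
        by (simp add: F_def absorb_pass_def absorb_def neighbours_adj[OF v])
      ultimately show "wp W (IfLess 13 9 (Seq (Add 10 4 5) (Store 10 2)) (Sub 10 0 0))
          (\<lambda>s'' t''. ready s'' \<and> regs s'' 5 = v \<and> I (Suc v) s'' \<and>
            t'' \<le> t' + 9 * (1 + length (adj ! v))) s1 t1"
        using v free_bounds by (simp add: I_def J_def ready_def marked_insert)
    qed (use s' in \<open>auto simp: I_def J_def ready_def\<close>)
    then show "wp W (Seq (Sub 9 0 0) (Seq (for_neighbours (Seq (Add 10 4 8)
            (Seq (Load 10 10) (Add 9 9 10))))
          (IfLess 13 9 (Seq (Add 10 4 5) (Store 10 2)) (Sub 10 0 0))))
         (\<lambda>s'' t''. ready s'' \<and> regs s'' 5 = v \<and> I (Suc v) s'' \<and>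
           t'' \<le> t' + 9 * (1 + length (adj ! v))) s' t'"
      by simp
  next
    fix s' t'
    assume "ready s'" "I n s'" "t' \<le> t + scan_time"
    then show "Q s' t'"
      by (intro post) (auto simp: I_def F_def)
  qed (use s in \<open>auto simp: I_def\<close>)
qed

lemma wp_repeat_absorb_marks:
  assumes "ready s" "memory s = marked X" "printed s = ys"
    and "\<And>s' t'. ready s' \<Longrightarrow> memory s' = marked ((absorb_pass d E [0..<n] ^^ k) X) \<Longrightarrow>
      printed s' = ys \<Longrightarrow> t' \<le> t + k * scan_time + 1 \<Longrightarrow> Q s' t'"
  shows "wp W (repeat k absorb_marks) Q s t"
  using assms
proof (induction k arbitrary: s t X)
  case 0
  have "Q (s\<lparr>regs := (regs s)(10 := 0)\<rparr>) (t + 1)"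
    by (rule "0.prems"(4)) (use "0.prems"(1-3) in \<open>auto simp: ready_def\<close>)
  then show ?case
    using "0.prems"(1) by (simp add: ready_def)
next
  case (Suc k)
  have "wp W absorb_marks (wp W (repeat k absorb_marks) Q) s t"
  proof (rule wp_absorb_marks[OF Suc.prems(1-3)])
    fix s' t'
    assume s': "ready s'" "memory s' = marked (absorb_pass d E [0..<n] X)" "printed s' = ys"
      "t' \<le> t + scan_time"
    show "wp W (repeat k absorb_marks) Q s' t'"
    proof (rule Suc.IH[OF s'(1-3)])
      fix s'' t''
      assume "ready s''" "printed s'' = ys" "t'' \<le> t' + k * scan_time + 1"
        "memory s'' = marked ((absorb_pass d E [0..<n] ^^ k) (absorb_pass d E [0..<n] X))"
      then show "Q s'' t''"
        using s'(4) by (intro Suc.prems(4)) (simp_all add: funpow_swap1)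
    qed
  qed
  then show ?case
    by simp
qed

text \<open>Pairs start at their end in \<open>X\<close> and follow the printing order; the prefix
  length \<open>v\<close> makes this usable as a loop invariant.\<close>

definition cut_list :: "nat set \<Rightarrow> nat \<Rightarrow> (nat \<times> nat) list" where
  "cut_list X v = concat (map (\<lambda>w. if w \<in> X then map (Pair w) (filter (\<lambda>u. u \<notin> X) (adj ! w)) else [])
     [0..<v])"

lemma wp_print_cut:
  assumes s: "ready s" "memory s = marked X" "printed s = []"
    and post: "\<And>s' t'. printed s' = concat (map (\<lambda>(u, v). [u, v]) (cut_list X n)) \<Longrightarrow>
      t' \<le> t + scan_time \<Longrightarrow> Q s' t'"
  shows "wp W print_cut Q s t"
proof -
  define code where "code = (\<lambda>ps. concat (map (\<lambda>(u, v :: nat). [u, v]) ps))"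
  have code: "code (ps @ qs) = code ps @ code qs" "code [] = []" "code [(a, b)] = [a, b]" for ps qs a b
    by (auto simp: code_def)
  define I where "I v s' \<longleftrightarrow> memory s' = marked X \<and> printed s' = code (cut_list X v)" for v and s' :: config
  show ?thesis
    unfolding print_cut_def
  proof (rule wp_for_vertices[where I = I])
    show "I 0 s"
      using s by (simp add: I_def cut_list_def code)
  next
    fix v s' t'
    assume v: "v < n" and s': "ready s'" "regs s' 5 = v" "I v s'"
    let ?post = "\<lambda>s'' t''. ready s'' \<and> regs s'' 5 = v \<and> I (Suc v) s'' \<and>
      t'' \<le> t' + 9 * (1 + length (adj ! v))"
    have nbrs: "wp W (for_neighbours (Seq (Add 10 4 8) (Seq (Load 10 10)
          (IfLess 10 2 (Seq (Print 5) (Print 8)) (Sub 10 0 0))))) ?post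
        (s'\<lparr>regs := (regs s')(10 := free + v, 9 := 1)\<rparr>) (t' + 3)" if vX: "v \<in> X"
    proof -
      define J where "J j s'' \<longleftrightarrow> memory s'' = marked X \<and> printed s'' = code (cut_list X v) @
        code (map (Pair v) (filter (\<lambda>u. u \<notin> X) (take j (adj ! v))))" for j and s'' :: config
      show ?thesis
      proof (rule wp_for_neighbours[where J = J, OF v])
        fix j s1 t1
        assume j: "j < length (adj ! v)"
          and s1: "ready s1" "regs s1 5 = v" "regs s1 8 = adj ! v ! j" "J j s1"
        have "adj ! v ! j < n"
          using adj_less[OF v nth_mem[OF j]] .
        then show "wp W (Seq (Add 10 4 8) (Seq (Load 10 10)
              (IfLess 10 2 (Seq (Print 5) (Print 8)) (Sub 10 0 0))))
            (\<lambda>s'' t''. ready s'' \<and> regs s'' 5 = v \<and> regs s'' 6 = regs s1 6 \<and> regs s'' 7 = regs s1 7 \<and>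
              J (Suc j) s'' \<and> t'' \<le> t1 + 5) s1 t1"
          using s1 j free_bounds
          by (simp add: J_def ready_def marked_vertex take_Suc_conv_app_nth code)
      next
        fix s1 t1
        assume "ready s1" "regs s1 5 = v" "J (length (adj ! v)) s1"
          "t1 \<le> t' + 3 + 5 + 8 * length (adj ! v)"
        then show "?post s1 t1"
          using vX by (simp add: I_def J_def cut_list_def code)
      qed (use s' in \<open>auto simp: I_def J_def ready_def code\<close>)
    qed
    show "wp W (Seq (Add 10 4 5) (Seq (Load 9 10) (IfLess 0 9
         (for_neighbours (Seq (Add 10 4 8) (Seq (Load 10 10)
            (IfLess 10 2 (Seq (Print 5) (Print 8)) (Sub 10 0 0)))))
         (Sub 10 0 0)))) ?post s' t'"
    proof (cases "v \<in> X")
      case True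
      then show ?thesis
        using nbrs s' v free_bounds by (simp add: I_def ready_def marked_vertex eval_nat_numeral)
    next
      case False
      then show ?thesis
        using s' v free_bounds by (simp add: I_def ready_def marked_vertex cut_list_def)
    qed
  next
    fix s' t'
    assume "I n s'" "t' \<le> t + scan_time"
    then show "Q s' t'"
      by (intro post) (auto simp: I_def code_def)
  qed (use s in \<open>auto simp: I_def\<close>)
qed

lemma set_cut_list:
  assumes "X \<subseteq> {..<n}"
  shows "(\<lambda>(u, v). {u, v}) ` set (cut_list X n) = {e \<in> E. \<exists>b\<in>X. \<exists>r\<in>{..<n} - X. e = {b, r}}"
proof -
  have "set (cut_list X n) = {(b, r). b \<in> X \<and> r \<notin> X \<and> r \<in> neighbours E b}"
    using assms by (fastforce simp: cut_list_def neighbours_adj[symmetric] split: if_splits)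
  moreover have "r < n" if "b \<in> X" "{b, r} \<in> E" for b r
    using that adj_less[of b r] neighbours_adj[of b] assms by (auto simp: neighbours_def)
  ultimately show ?thesis
    by (auto simp: neighbours_def image_iff) (metis Diff_iff lessThan_iff)
qed

text \<open>The set \<open>B\<close> of \<open>absorb_passes_d_cut\<close> for the enumeration
  \<open>[0..<n]\<close>.\<close>

definition output_set :: "nat \<Rightarrow> nat set" where
  "output_set v = (absorb_pass d E [0..<n] ^^ pass_count d)
     ({..<n} - (absorb_pass d E [0..<n] ^^ pass_count d) ({..<n} - insert v (neighbours E v)))"

lemma absorb_passes_subset:
  "X \<subseteq> {..<n} \<Longrightarrow> (absorb_pass d E [0..<n] ^^ k) X \<subseteq> {..<n}"
  by (rule absorb_passes_invariant[where I = "\<lambda>Y. Y \<subseteq> {..<n}"]) (auto simp: absorb_def)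

text \<open>There are \<open>2 * pass_count d\<close> absorbing scans and at most five further ones:
  maximum degree, marking, two complements and printing. A sixth covers the constant
  overhead.\<close>

lemma wp_d_cut_program:
  "wp W (d_cut_program d) (\<lambda>s t. t \<le> (2 * pass_count d + 6) * scan_time \<and>
     (\<exists>v<n. (\<forall>w<n. degree E w \<le> degree E v) \<and>
       printed s = concat (map (\<lambda>(u, v). [u, v]) (cut_list (output_set v) n))))
   (initial_config (encode_graph adj)) 0"
  unfolding d_cut_program_def wp_Seq
proof (rule wp_prepare[OF refl], rule wp_find_max_degree, assumption+)
  let ?passes = "absorb_pass d E [0..<n] ^^ pass_count d"
  fix s0 s1 :: config and t0 t1 :: nat
  define v where "v = regs s1 11"
  assume t0: "t0 \<le> 0 + 5" and s1: "ready s1" "memory s1 = marked {}" "printed s1 = []" "regs s1 11 < n"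
    and max: "\<And>w. w < n \<Longrightarrow> length (adj ! w) \<le> length (adj ! regs s1 11)"
    and t1: "t1 \<le> t0 + scan_time"
  have v: "v < n" and nv: "insert v (neighbours E v) \<subseteq> {..<n}"
    using s1(4) adj_less neighbours_adj by (auto simp: v_def)
  have deg: "degree E w \<le> degree E v" if "w < n" for w
    using max[OF that] that v by (simp add: degree_def neighbours_adj distinct_adj distinct_card v_def)
  show "wp W mark_closed_neighbourhood (wp W complement_marks (wp W (repeat (pass_count d) absorb_marks)
      (wp W complement_marks (wp W (repeat (pass_count d) absorb_marks) (wp W print_cut
        (\<lambda>s t. t \<le> (2 * pass_count d + 6) * scan_time \<and> (\<exists>v<n. (\<forall>w<n. degree E w \<le> degree E v) \<and>
          printed s = concat (map (\<lambda>(u, v). [u, v]) (cut_list (output_set v) n)))))))))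
    s1 t1"
  proof (rule wp_mark_closed_neighbourhood[OF s1(1-3) v_def[symmetric] v])
    fix s2 t2
    assume s2: "ready s2" "memory s2 = marked (insert v ({} \<union> set (adj ! v)))" "printed s2 = []"
      and t2: "t2 \<le> t1 + scan_time"
    then have mem2: "memory s2 = marked (insert v (neighbours E v))"
      by (simp add: neighbours_adj[OF v])
    show "wp W complement_marks (wp W (repeat (pass_count d) absorb_marks)
      (wp W complement_marks (wp W (repeat (pass_count d) absorb_marks) (wp W print_cut
        (\<lambda>s t. t \<le> (2 * pass_count d + 6) * scan_time \<and> (\<exists>v<n. (\<forall>w<n. degree E w \<le> degree E v) \<and>
          printed s = concat (map (\<lambda>(u, v). [u, v]) (cut_list (output_set v) n))))))))
    s2 t2"
    proof (rule wp_complement_marks[OF s2(1) mem2 s2(3) nv], rule wp_repeat_absorb_marks, assumption+)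
      fix s3 s4 :: config and t3 t4 :: nat
      assume t3: "t3 \<le> t2 + scan_time" and t4: "t4 \<le> t3 + pass_count d * scan_time + 1"
        and s4: "ready s4" "memory s4 = marked (?passes ({..<n} - insert v (neighbours E v)))"
          "printed s4 = []"
      have sub: "?passes ({..<n} - insert v (neighbours E v)) \<subseteq> {..<n}"
        by (intro absorb_passes_subset) auto
      show "wp W complement_marks (wp W (repeat (pass_count d) absorb_marks) (wp W print_cut
          (\<lambda>s t. t \<le> (2 * pass_count d + 6) * scan_time \<and> (\<exists>v<n. (\<forall>w<n. degree E w \<le> degree E v) \<and>
            printed s = concat (map (\<lambda>(u, v). [u, v]) (cut_list (output_set v) n))))))
        s4 t4"
      proof (rule wp_complement_marks[OF s4 sub], rule wp_repeat_absorb_marks, assumption+,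
          rule wp_print_cut, assumption+)
        fix s5 s6 s7 :: config and t5 t6 t7 :: nat
        assume "t5 \<le> t4 + scan_time" "t6 \<le> t5 + pass_count d * scan_time + 1" "t7 \<le> t6 + scan_time"
        \<comment> \<open>The overhead is 5 units for \<open>prepare\<close> and 1 for the end of
          each \<open>repeat\<close>.\<close>
        moreover have "7 \<le> scan_time"
          using free_bounds by (simp add: scan_time_def)
        ultimately have "t7 \<le> (2 * pass_count d + 6) * scan_time"
          using t0 t1 t2 t3 t4 by (simp add: algebra_simps)
        moreover assume "printed s7 = concat (map (\<lambda>(u, v). [u, v]) (cut_list
          (?passes ({..<n} - ?passes ({..<n} - insert v (neighbours E v)))) n))"
        ultimately show "t7 \<le> (2 * pass_count d + 6) * scan_time \<and>
            (\<exists>v<n. (\<forall>w<n. degree E w \<le> degree E v) \<and>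
            printed s7 = concat (map (\<lambda>(u, v). [u, v]) (cut_list (output_set v) n)))"
          using v deg unfolding output_set_def by blast
      qed
    qed
  qed
qed

end

text \<open>Bounded degree makes the encoding linear in \<open>n\<close>, so a constant number of
  scans takes linear time. The same \<open>W\<close> bounds the words and the time.\<close>

lemma d_cut_program_correct:
  assumes d: "d \<ge> 2" and G: "simple_graph {..<n} E" and claw: "claw_free {..<n} E"
    and maxdeg: "max_degree {..<n} E \<le> 2 * d + 1" and large: "n > 4 * d ^ 2 * (2 * d + 1)"
    and adj: "adjacency_lists n E adj"
    and W: "W = (2 * pass_count d + 6) * (11 * (2 * d + 5)) * (n + card E)"
  shows "\<exists>t ys M. runs W (d_cut_program d) (encode_graph adj) t ys \<and> t \<le> W \<and>
    encodes_edges ys M \<and> d_cut d {..<n} E M"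
proof -
  have len: "length adj = n" and nb: "\<And>v. v < n \<Longrightarrow> set (adj ! v) = neighbours E v \<and> distinct (adj ! v)"
    using adj by (auto simp: adjacency_lists_def)
  have deg: "degree E v \<le> 2 * d + 1" if "v < n" for v
    using degree_le_max_degree[OF G, of v] maxdeg that by simp
  have n: "0 < n" "(2 * d + 2) * (d + 1) < n"
    using large d_cut_size_bound[OF d] by auto
  have "length (adj ! v) \<le> 2 * d + 1" if "v < n" for v
    using deg[OF that] nb[OF that] by (simp add: degree_def distinct_card[symmetric])
  then have step: "list_address adj (Suc v) \<le> list_address adj v + (2 * d + 1)" if "v < n" for v
    using that by (simp add: list_address_Suc len)
  have "v \<le> n \<Longrightarrow> list_address adj v \<le> n + 2 + v * (2 * d + 1)" for v
  proof (induction v)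
    case (Suc v)
    then show ?case
      using step[of v] by simp
  qed (simp add: len list_address_def)
  \<comment> \<open>The additive 2 is absorbed into \<open>2 * n\<close>, as \<open>n\<close> is
    positive.\<close>
  from this[of n] have addr: "list_address adj n + n \<le> (2 * d + 5) * n"
    using n(1) by (simp add: algebra_simps)
  have W_ge: "(2 * pass_count d + 6) * (11 * ((2 * d + 5) * n)) \<le> W"
    by (simp add: W algebra_simps)
  have "(2 * d + 5) * n \<le> (2 * pass_count d + 6) * (11 * ((2 * d + 5) * n))"
    by simp
  then have nW: "(2 * d + 5) * n \<le> W"
    using W_ge by linarith
  have "d * 1 \<le> (2 * d + 5) * n"
    using n(1) by (intro mult_le_mono) auto
  then interpret adjacency_input n d W adj E
    using addr nW len nb n(1) neighbours_subset[OF G] adj by unfold_locales auto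
  obtain t s v where exec: "exec W (d_cut_program d) (initial_config (encode_graph adj)) t s"
    and t: "t \<le> (2 * pass_count d + 6) * scan_time"
    and v: "v < n" "\<And>w. w < n \<Longrightarrow> degree E w \<le> degree E v"
    and out: "printed s = concat (map (\<lambda>(u, v). [u, v]) (cut_list (output_set v) n))"
    using wp_d_cut_program unfolding wp_def by auto
  have "x \<le> W" if x: "x \<in> set (encode_graph adj)" for x
  proof -
    consider "x = n" | v where "x = addr v" | l where "l \<in> set adj" "x \<in> set l"
      using x by (auto simp: encode_graph_def list_address_def len simp del: upt_Suc)
    then have "x \<le> free \<or> x \<le> n"
    proof cases
      case 3
      then show ?thesis
        using adj_less len by (metis in_set_conv_nth less_imp_le)
    qed (use addr_le in auto)
    then show ?thesis
      using free_bounds by auto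
  qed
  then have "runs W (d_cut_program d) (encode_graph adj) t (printed s)"
    using exec unfolding runs_def by blast
  moreover have "t \<le> W"
  proof -
    have "scan_time \<le> 11 * ((2 * d + 5) * n)"
      using addr by (simp add: scan_time_def free_def)
    then have "(2 * pass_count d + 6) * scan_time \<le> (2 * pass_count d + 6) * (11 * ((2 * d + 5) * n))"
      by (rule mult_le_mono2)
    then show ?thesis
      using t W_ge by linarith
  qed
  moreover have "encodes_edges (printed s) {e \<in> E. \<exists>b\<in>output_set v. \<exists>r\<in>{..<n} - output_set v. e = {b, r}}"
  proof -
    have "output_set v \<subseteq> {..<n}"
      unfolding output_set_def by (intro absorb_passes_subset) auto
    then show ?thesis
      unfolding encodes_edges_def using out set_cut_list by (intro exI[of _ "cut_list (output_set v) n"]) simp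
  qed
  moreover have "d_cut d {..<n} E {e \<in> E. \<exists>b\<in>output_set v. \<exists>r\<in>{..<n} - output_set v. e = {b, r}}"
    by (rule absorb_passes_d_cut[OF _ G claw _ _ _ _ _ refl output_set_def])
      (use d n v deg in auto)
  ultimately show ?thesis
    by blast
qed

section \<open>Powers of cycles\<close>

text \<open>For \<open>2 * r < n\<close>, the \<open>r\<close>-th power of the cycle on
  \<open>{..<n}\<close>.\<close>

definition cycle_power_edges :: "nat \<Rightarrow> nat \<Rightarrow> nat set set" where
  "cycle_power_edges n r = {{i, (i + k) mod n} | i k. i < n \<and> 1 \<le> k \<and> k \<le> r}"

lemma mod_add_cancel_less:
  fixes i j k n :: nat
  assumes "(i + j) mod n = (i + k) mod n" "j < n" "k < n"
  shows "j = k"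
proof -
  have "(int i + int j) mod int n = (int i + int k) mod int n"
    using assms(1) by (metis of_nat_add zmod_int)
  then have "int j mod int n = int k mod int n"
    by (metis mod_add_left_eq add_diff_cancel_left' mod_diff_left_eq)
  then show ?thesis
    using assms(2,3) by simp
qed

text \<open>Going back by \<open>k\<close> means going forward by \<open>n - k\<close> modulo
  \<open>n\<close>.\<close>

lemma neighbours_cycle_power:
  assumes r: "2 * r < n" and v: "v < n"
  shows "neighbours (cycle_power_edges n r) v = (\<lambda>k. (v + k) mod n) ` ({1..r} \<union> {n - r..<n})"
proof -
  have inverse: "((w + k) mod n + (n - k)) mod n = w" if "k \<le> n" "w < n" for k w
    using mod_add_left_eq[of "w + k" n "n - k"] that by simp
  show ?thesis
  proof (intro equalityI subsetI)
    fix u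
    assume "u \<in> neighbours (cycle_power_edges n r) v"
    then obtain i k where ik: "{v, u} = {i, (i + k) mod n}" "i < n" "1 \<le> k" "k \<le> r"
      by (auto simp: neighbours_def cycle_power_edges_def)
    then consider "u = (v + k) mod n" | "v = (u + k) mod n" "u < n"
      by (auto simp: doubleton_eq_iff)
    then show "u \<in> (\<lambda>k. (v + k) mod n) ` ({1..r} \<union> {n - r..<n})"
    proof cases
      case 2
      then have "u = (v + (n - k)) mod n"
        using inverse[of k u] ik r by simp
      moreover have "n - k \<in> {n - r..<n}"
        using ik r by auto
      ultimately show ?thesis
        by blast
    qed (use ik in auto)
  next
    fix u
    assume "u \<in> (\<lambda>k. (v + k) mod n) ` ({1..r} \<union> {n - r..<n})"
    then obtain k where k: "u = (v + k) mod n" "k \<in> {1..r} \<or> k \<in> {n - r..<n}"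
      by auto
    from k(2) show "u \<in> neighbours (cycle_power_edges n r) v"
    proof
      assume "k \<in> {1..r}"
      then show ?thesis
        using k(1) v by (auto simp: neighbours_def cycle_power_edges_def)
    next
      assume kr: "k \<in> {n - r..<n}"
      then have "{v, u} = {u, (u + (n - k)) mod n}"
        using inverse[of k v] v k(1) by auto
      moreover have "1 \<le> n - k" "n - k \<le> r" "u < n"
        using kr k(1) v by auto
      ultimately show ?thesis
        unfolding neighbours_def cycle_power_edges_def by blast
    qed
  qed
qed

lemma simple_graph_cycle_power:
  assumes "2 * r < n"
  shows "simple_graph {..<n} (cycle_power_edges n r)"
proof -
  have "(i + k) mod n \<noteq> i" if "i < n" "1 \<le> k" "k \<le> r" for i k
    using mod_add_cancel_less[of i k n 0] that assms by auto
  then have "card {i, (i + k) mod n} = 2" if "i < n" "1 \<le> k" "k \<le> r" for i k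
    using that by (metis card_2_iff)
  then show ?thesis
    unfolding simple_graph_def cycle_power_edges_def by auto
qed

text \<open>Forward and backward offsets are disjoint, and distinct offsets below \<open>n\<close>
  reach distinct vertices.\<close>

lemma regular_cycle_power:
  assumes r: "2 * r < n"
  shows "regular (2 * r) {..<n} (cycle_power_edges n r)"
  unfolding regular_def degree_def
proof
  fix v
  assume "v \<in> {..<n}"
  then have "card (neighbours (cycle_power_edges n r) v) = card ({1..r} \<union> {n - r..<n})"
    using r by (auto simp: neighbours_cycle_power intro!: card_image inj_onI dest: mod_add_cancel_less)
  also have "\<dots> = 2 * r"
    using r by (subst card_Un_disjoint) auto
  finally show "card (neighbours (cycle_power_edges n r) v) = 2 * r" .
qed

text \<open>Measuring offsets from a common base point \<open>v\<close> avoids case distinctions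
  about wrap-around.\<close>

lemma cycle_power_adjacent:
  assumes "2 * r < n" "i < j" "j - i \<le> r"
  shows "(v + j) mod n \<in> neighbours (cycle_power_edges n r) ((v + i) mod n)"
proof -
  have "(v + j) mod n = ((v + i) mod n + (j - i)) mod n"
    using mod_add_left_eq[of "v + i" n "j - i"] assms(2) by simp
  moreover have "j - i \<in> {1..r}"
    using assms by auto
  moreover have "(v + i) mod n < n"
    using assms by simp
  ultimately show ?thesis
    using assms(1) by (subst neighbours_cycle_power) auto
qed

text \<open>A neighbourhood is the union of two cliques, the \<open>r\<close> vertices ahead and the
  \<open>r\<close> behind; two of any three neighbours share a clique.\<close>

lemma claw_free_cycle_power:
  assumes r: "2 * r < n"
  shows "claw_free {..<n} (cycle_power_edges n r)"
proof -
  let ?N = "neighbours (cycle_power_edges n r)"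
  have arc: "(v + i) mod n \<in> ?N ((v + j) mod n)"
    if ne: "(v + i) mod n \<noteq> (v + j) mod n" and I: "i \<in> I" "j \<in> I" "I = {1..r} \<or> I = {n - r..<n}"
    for v i j I
  proof -
    have "i \<noteq> j"
      using ne by auto
    moreover have "j - i \<le> r" "i - j \<le> r"
      using I r by auto
    ultimately consider "i < j" "j - i \<le> r" | "j < i" "i - j \<le> r"
      by linarith
    then show ?thesis
      using cycle_power_adjacent[OF r, of i j v] cycle_power_adjacent[OF r, of j i v]
        neighbours_sym[of "(v + i) mod n" _ "(v + j) mod n"] by cases auto
  qed
  have "a \<in> ?N b \<or> a \<in> ?N c \<or> b \<in> ?N c"
    if v: "v < n" and abc: "{a, b, c} \<subseteq> ?N v" "distinct [a, b, c]" for v a b c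
  proof -
    define L where "L = (\<lambda>k. (v + k) mod n) ` {1..r}"
    define R where "R = (\<lambda>k. (v + k) mod n) ` {n - r..<n}"
    have "?N v = L \<union> R"
      unfolding L_def R_def neighbours_cycle_power[OF r v] by blast
    moreover have "x \<in> ?N y" if "x \<noteq> y" "Z = L \<or> Z = R" "x \<in> Z" "y \<in> Z" for x y Z
      using that arc[of v] unfolding L_def R_def by auto
    ultimately show ?thesis
      using abc by auto
  qed
  then show ?thesis
    unfolding claw_free_iff[OF simple_graph_cycle_power[OF r]] by blast
qed

text \<open>Two consecutive vertices lie on the same side of every \<open>d\<close>-cut, since the arc of \<open>2 * d + 2\<close>
  vertices around them consists of common closed neighbours: otherwise each side would contain
  at most \<open>d\<close> vertices of the arc.\<close>

lemma cycle_power_no_d_cut: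
  assumes n: "2 * d + 2 < n"
  shows "\<not> d_cut d {..<n} (cycle_power_edges n (d + 1)) M"
proof
  let ?E = "cycle_power_edges n (d + 1)"
  have r: "2 * (d + 1) < n"
    using n by simp
  note G = simple_graph_cycle_power[OF r]
  assume "d_cut d {..<n} ?E M"
  then obtain B R where BR: "B \<union> R = {..<n}" "B \<inter> R = {}" "B \<noteq> {}" "R \<noteq> {}"
    and B: "\<And>v. v \<in> B \<Longrightarrow> card (neighbours ?E v \<inter> R) \<le> d"
    and R: "\<And>v. v \<in> R \<Longrightarrow> card (neighbours ?E v \<inter> B) \<le> d"
    unfolding d_cut_def by blast
  \<comment> \<open>Stated for a generic pair of sides, since the earlier of the two vertices may
    lie in \<open>B\<close> or in \<open>R\<close>.\<close>
  have arc: "False"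
    if xy: "x \<in> S" "y \<in> T" "x = (i + d) mod n" "y = (i + (d + 1)) mod n"
      and ST: "S \<union> T = {..<n}" "S \<inter> T = {}"
      and S: "\<And>v. v \<in> S \<Longrightarrow> card (neighbours ?E v \<inter> T) \<le> d"
      and T: "\<And>v. v \<in> T \<Longrightarrow> card (neighbours ?E v \<inter> S) \<le> d" for i x y S T
  proof -
    \<comment> \<open>\<open>x\<close> and \<open>y\<close> are the middle vertices of this arc, at
      offsets \<open>d\<close> and \<open>d + 1\<close>, so no vertex of it is more than
      \<open>d + 1\<close> away from either.\<close>
    define A where "A = (\<lambda>k. (i + k) mod n) ` {..<2 * d + 2}"
    have cl: "(i + k) mod n \<in> insert ((i + j) mod n) (neighbours ?E ((i + j) mod n))"
      if kj: "k < 2 * d + 2" "j = d \<or> j = d + 1" for k j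
    proof -
      consider "k = j" | "j < k" "k - j \<le> d + 1" | "k < j" "j - k \<le> d + 1"
        using kj by linarith
      then show ?thesis
        using cycle_power_adjacent[OF r, of k j i] cycle_power_adjacent[OF r, of j k i]
          neighbours_sym[of "(i + k) mod n" _ "(i + j) mod n"] by cases auto
    qed
    have "A \<subseteq> {..<n}"
      using n by (auto simp: A_def)
    have "A \<subseteq> insert x (neighbours ?E x)" "A \<subseteq> insert y (neighbours ?E y)"
      using cl xy(3,4) unfolding A_def by blast+
    then have "A \<inter> T \<subseteq> neighbours ?E x \<inter> T" "A \<inter> S \<subseteq> neighbours ?E y \<inter> S"
      using xy(1,2) ST(2) by auto
    then have "card (A \<inter> T) \<le> d" "card (A \<inter> S) \<le> d"
      using S[OF xy(1)] T[OF xy(2)] finite_neighbours[OF G]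
      by (meson card_mono finite_Int le_trans)+
    moreover have "card A = card (A \<inter> S) + card (A \<inter> T)"
      using ST \<open>A \<subseteq> {..<n}\<close> finite_subset[OF \<open>A \<subseteq> {..<n}\<close>]
      by (subst card_Un_disjoint[symmetric]) (auto intro!: arg_cong[of _ _ card])
    moreover have "card A = 2 * d + 2"
      unfolding A_def
      using n by (subst card_image) (auto intro!: inj_onI dest: mod_add_cancel_less)
    ultimately show False
      by simp
  qed
  have step: "k \<in> B \<longleftrightarrow> Suc k \<in> B" if k: "Suc k < n" for k
  proof -
    \<comment> \<open>The base point is \<open>k - d\<close> modulo \<open>n\<close>; adding
      \<open>n\<close> first prevents truncation.\<close>
    have idx: "k = (k + n - d + d) mod n" "Suc k = (k + n - d + (d + 1)) mod n"
      using k n by (auto simp: mod_if)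
    have "k \<in> B \<union> R" "Suc k \<in> B \<union> R" "R \<union> B = {..<n}" "R \<inter> B = {}"
      using k BR(1,2) by auto
    then show ?thesis
      using arc[OF _ _ idx BR(1,2) B R] arc[OF _ _ idx _ _ R B] BR(2) by blast
  qed
  have "k \<in> B \<longleftrightarrow> 0 \<in> B" if "k < n" for k
    using that by (induction k) (use step in auto)
  then have "B = {..<n} \<or> B = {}"
    using BR(1) by auto
  then show False
    using BR by auto
qed

lemma large_graphs_without_d_cut:
  "\<exists>(V :: nat set) E. simple_graph V E \<and> card V \<ge> N \<and> claw_free V E \<and>
     regular (2 * d + 2) V E \<and> \<not> (\<exists>M. d_cut d V E M)"
proof -
  \<comment> \<open>At least \<open>N\<close>, and beyond \<open>2 * d + 2\<close> so that offsets
    do not collide.\<close>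
  define n where "n = N + 2 * d + 3"
  have n: "2 * (d + 1) < n" "2 * d + 2 < n"
    by (auto simp: n_def)
  have "regular (2 * d + 2) {..<n} (cycle_power_edges n (d + 1))"
    using regular_cycle_power[OF n(1)] by simp
  moreover have "card {..<n} \<ge> N"
    by (simp add: n_def)
  ultimately show ?thesis
    using simple_graph_cycle_power[OF n(1)] claw_free_cycle_power[OF n(1)]
      cycle_power_no_d_cut[OF n(2)] by metis
qed

section \<open>Existence, linear time and the regular graphs combined\<close>

theorem theorem1p3:
  fixes d :: nat
  assumes "d \<ge> 2"
  shows
    "(\<forall>(V :: 'a set) E.
        simple_graph V E \<and> claw_free V E \<and> max_degree V E \<le> 2 * d + 1 \<and>
        card V > 4 * d ^ 2 * (2 * d + 1) \<longrightarrow>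
        (\<exists>M. d_cut d V E M)) \<and>
     (\<exists>P K. \<forall>n E adj.
        simple_graph {..<n} E \<and> claw_free {..<n} E \<and> max_degree {..<n} E \<le> 2 * d + 1 \<and>
        n > 4 * d ^ 2 * (2 * d + 1) \<and> adjacency_lists n E adj \<longrightarrow>
        (\<exists>t ys M. runs (K * (n + card E)) P (encode_graph adj) t ys \<and>
           t \<le> K * (n + card E) \<and> encodes_edges ys M \<and> d_cut d {..<n} E M)) \<and>
     (\<forall>N. \<exists>(V :: nat set) E.
        simple_graph V E \<and> card V \<ge> N \<and> claw_free V E \<and> regular (2 * d + 2) V E \<and>
        \<not> (\<exists>M. d_cut d V E M))"
proof (intro conjI allI impI)
  show "\<exists>M. d_cut d V E M"
    if "simple_graph V E \<and> claw_free V E \<and> max_degree V E \<le> 2 * d + 1 \<and>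
      card V > 4 * d ^ 2 * (2 * d + 1)" for V :: "'a set" and E
    using d_cut_exists[OF assms] that by blast
next
  show "\<exists>P K. \<forall>n E adj.
        simple_graph {..<n} E \<and> claw_free {..<n} E \<and> max_degree {..<n} E \<le> 2 * d + 1 \<and>
        n > 4 * d ^ 2 * (2 * d + 1) \<and> adjacency_lists n E adj \<longrightarrow>
        (\<exists>t ys M. runs (K * (n + card E)) P (encode_graph adj) t ys \<and>
           t \<le> K * (n + card E) \<and> encodes_edges ys M \<and> d_cut d {..<n} E M)"
    \<comment> \<open>Both the program and the constant depend on \<open>d\<close> alone.\<close>
    by (intro exI[of _ "d_cut_program d"] exI[of _ "(2 * pass_count d + 6) * (11 * (2 * d + 5))"]
        allI impI d_cut_program_correct[OF assms]) auto
next
  show "\<exists>(V :: nat set) E. simple_graph V E \<and> card V \<ge> N \<and> claw_free V E \<and>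
      regular (2 * d + 2) V E \<and> \<not> (\<exists>M. d_cut d V E M)" for N
    by (rule large_graphs_without_d_cut)
qed

end
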